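(* There is an absolute constant $c>0$ such that the following holds. Let $n$ be the number of players and of items, and let $u_{ij}\in[0,1]$ ($i,j\in[n]$) be utilities with $\min_j u_{ij}=0$ and $\max_j u_{ij}=1$ for each $i$. Let $\bar\lambda>10$, and consider a $T$-round execution of the regularized algorithm (defined in the context) with regularizer $F_0(x)=\sum_{i,j}f_0(x_{ij})$, $f_0(z)=-\beta/z$, $\beta=\bar\lambda^{-3}n^{-4}$, with bids $\lambda_{i,t}\in[0,\bar\lambda]$. Suppose that each player has strong regret $<\varepsilon T$, where $0<\varepsilon\le c\,\bar\lambda^{-12}n^{-22}$. Let $x$ be the resulting allocation. For each player $i$ let $\lambda_i$ be the (capped) best response of player $i$, and let $C_j$ be the VCG prices corresponding to the utilities $\lambda_iu_{ij}$. Put $\delta=10\,\bar\lambda^{-1}<1$. Then $x$ is a $\delta$-competitive equilibrium at budgets $1$ supported by the prices $C'_j=(1-\delta/3)\,C_j$.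
   Context: Regularized algorithm. Allocations are bistochastic matrices $x=(x_{kj})\in[0,1]^{n\times n}$. In each round $t\in[T]$ each player $k$ submits a bid $\lambda_{k,t}\ge 0$. The round's allocation $x^t$ is the unique maximizer over bistochastic matrices of $F_0(x)+\sum_{k,j}\lambda_{k,t}u_{kj}x_{kj}$ (with $F_0=-\infty$ if some entry is $0$). Writing $\mathrm{OPT}_0(\lambda):=\max_x\big(F_0(x)+\sum_{k,j}\lambda_ku_{kj}x_{kj}\big)$ and $\lambda^{-i}$ for $\lambda$ with the $i$-th coordinate replaced by $0$, player $i$ pays in round $t$ $$P_{i,t}=\mathrm{OPT}_0(\lambda_{\cdot,t}^{-i})-\Big(\mathrm{OPT}_0(\lambda_{\cdot,t})-\sum_j\lambda_{i,t}u_{ij}x^t_{ij}\Big).$$ Each player has total budget $T$, and an execution is required to be feasible: $\sum_tP_{i,t}\le T$ for each $i$. The resulting allocation is $x=\frac1T\sum_tx^t$. For fixed bids of the other players, let $P_{i,t}(\lambda)$ and $U_{i,t}(\lambda)=\sum_ju_{ij}x_{ij}$ denote the payment and the utility of player $i$ in round $t$ if she bids $\lambda$ instead of $\lambda_{i,t}$. Strong regret. Player $i$ has strong regret $<\varepsilon T$ if the supremum of $\mathbb E[\sum_tU_{i,t}(\lambda'_t)]-\sum_tU_{i,t}(\lambda_{i,t})$ over all probability distributions on sequences $(\lambda'_t)\in[0,\bar\lambda]^T$ with $\mathbb E[\sum_tP_{i,t}(\lambda'_t)]\le T$ is $<\varepsilon T$. Best response. Given the other players' bids, there is a unique sequence in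 $[0,\infty)^T$ maximizing $\sum_tU_{i,t}(\lambda_t)$ subject to $\sum_tP_{i,t}(\lambda_t)\le T$, and it is constant in $t$; $\lambda_i$ is defined as the minimum of this constant value and $\bar\lambda$. VCG prices. For utilities $v_{ij}\ge0$, the (unregularized) VCG price of item $j$ is $\mathrm{OPT}_{+j}(v)-\mathrm{OPT}(v)$, where $\mathrm{OPT}(v)=\max_\pi\sum_iv_{i\pi(i)}$ over permutations and $\mathrm{OPT}_{+j}(v)$ is the same maximum when a second copy of item $j$ is available (injections from players to items together with the copy). $\delta$-competitive equilibrium at budgets $1$. A bistochastic $x$ is a $\delta$-competitive equilibrium at budgets $1$ supported by prices $C'_j$ if for every player $i$: $\sum_jC'_jx_{ij}\le1$, and for every $y_{ij}\ge0$ with $\sum_jy_{ij}=1$ and $\sum_jC'_jy_{ij}\le1$ one has $\sum_ju_{ij}y_{ij}\le\sum_ju_{ij}x_{ij}+\delta$. *)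

theory Defs
  imports "HOL-Probability.Probability" "HOL-Combinatorics.Permutations"
begin

text \<open>
  Players and items are both indexed by \<open>{..<n}\<close>; matrices are functions \<open>nat \<Rightarrow> nat \<Rightarrow> real\<close>.
  Bistochastic matrices vanish outside \<open>{..<n} \<times> {..<n}\<close>, so that equality of functions is
  equality of matrices and a maximizer over them can be unique.
\<close>

definition bistochastic :: "nat \<Rightarrow> (nat \<Rightarrow> nat \<Rightarrow> real) set" where
  "bistochastic n = {x.
     (\<forall>k<n. \<forall>j<n. x k j \<in> {0..1}) \<and>
     (\<forall>k<n. (\<Sum>j<n. x k j) = 1) \<and>
     (\<forall>j<n. (\<Sum>k<n. x k j) = 1) \<and>
     (\<forall>k j. \<not> (k < n \<and> j < n) \<longrightarrow> x k j = 0)}"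

text \<open>
  Regularizers take values in \<^typ>\<open>ereal\<close>. The value at \<open>0\<close> must be given explicitly, because
  division by zero yields zero.
\<close>

definition inverse_barrier :: "real \<Rightarrow> real \<Rightarrow> ereal" where
  "inverse_barrier \<beta> z = (if z = 0 then -\<infinity> else ereal (- \<beta> / z))"

definition separable_regularizer ::
  "nat \<Rightarrow> (real \<Rightarrow> ereal) \<Rightarrow> (nat \<Rightarrow> nat \<Rightarrow> real) \<Rightarrow> ereal" where
  "separable_regularizer n f x = (\<Sum>i<n. \<Sum>j<n. f (x i j))"


subsection \<open>One round of the regularized algorithm\<close>

text \<open>
  Common parameters: \<open>n\<close>, the regularizer \<open>F\<close>, the utilities \<open>u\<close>, and a bid profile
  \<open>l :: nat \<Rightarrow> real\<close> (one bid per player).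
\<close>

definition objective ::
  "nat \<Rightarrow> ((nat \<Rightarrow> nat \<Rightarrow> real) \<Rightarrow> ereal) \<Rightarrow> (nat \<Rightarrow> nat \<Rightarrow> real) \<Rightarrow> (nat \<Rightarrow> real) \<Rightarrow>
   (nat \<Rightarrow> nat \<Rightarrow> real) \<Rightarrow> ereal" where
  "objective n F u l x = F x + ereal (\<Sum>k<n. \<Sum>j<n. l k * u k j * x k j)"

definition allocation ::
  "nat \<Rightarrow> ((nat \<Rightarrow> nat \<Rightarrow> real) \<Rightarrow> ereal) \<Rightarrow> (nat \<Rightarrow> nat \<Rightarrow> real) \<Rightarrow> (nat \<Rightarrow> real) \<Rightarrow>
   nat \<Rightarrow> nat \<Rightarrow> real" where
  "allocation n F u l =
     (THE x. is_arg_max (objective n F u l) (\<lambda>x. x \<in> bistochastic n) x)"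

text \<open>
  For the regularizer built from \<^const>\<open>inverse_barrier\<close> the supremum below is finite and
  attained.
\<close>

definition opt0 ::
  "nat \<Rightarrow> ((nat \<Rightarrow> nat \<Rightarrow> real) \<Rightarrow> ereal) \<Rightarrow> (nat \<Rightarrow> nat \<Rightarrow> real) \<Rightarrow> (nat \<Rightarrow> real) \<Rightarrow> real" where
  "opt0 n F u l = real_of_ereal (SUP x\<in>bistochastic n. objective n F u l x)"

definition utility ::
  "nat \<Rightarrow> ((nat \<Rightarrow> nat \<Rightarrow> real) \<Rightarrow> ereal) \<Rightarrow> (nat \<Rightarrow> nat \<Rightarrow> real) \<Rightarrow> nat \<Rightarrow> (nat \<Rightarrow> real) \<Rightarrow> real" where
  "utility n F u i l = (\<Sum>j<n. u i j * allocation n F u l i j)"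

definition payment ::
  "nat \<Rightarrow> ((nat \<Rightarrow> nat \<Rightarrow> real) \<Rightarrow> ereal) \<Rightarrow> (nat \<Rightarrow> nat \<Rightarrow> real) \<Rightarrow> nat \<Rightarrow> (nat \<Rightarrow> real) \<Rightarrow> real" where
  "payment n F u i l =
     opt0 n F u (l(i := 0)) - (opt0 n F u l - (\<Sum>j<n. l i * u i j * allocation n F u l i j))"


subsection \<open>Executions with \<open>T\<close> rounds\<close>

text \<open>
  Rounds are \<open>{..<T}\<close> and \<open>b t k\<close> is the bid of player \<open>k\<close> in round \<open>t\<close>, so \<open>(b t)(i := s t)\<close>
  is the profile of round \<open>t\<close> after player \<open>i\<close> deviates to the bid \<open>s t\<close>.
\<close>

definition feasible_execution ::
  "nat \<Rightarrow> ((nat \<Rightarrow> nat \<Rightarrow> real) \<Rightarrow> ereal) \<Rightarrow> (nat \<Rightarrow> nat \<Rightarrow> real) \<Rightarrow> real \<Rightarrow> nat \<Rightarrow>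
   (nat \<Rightarrow> nat \<Rightarrow> real) \<Rightarrow> bool" where
  "feasible_execution n F u L T b \<longleftrightarrow>
     (\<forall>t<T. \<forall>k<n. b t k \<in> {0..L}) \<and>
     (\<forall>i<n. (\<Sum>t<T. payment n F u i (b t)) \<le> real T)"

definition average_allocation ::
  "nat \<Rightarrow> ((nat \<Rightarrow> nat \<Rightarrow> real) \<Rightarrow> ereal) \<Rightarrow> (nat \<Rightarrow> nat \<Rightarrow> real) \<Rightarrow> nat \<Rightarrow>
   (nat \<Rightarrow> nat \<Rightarrow> real) \<Rightarrow> nat \<Rightarrow> nat \<Rightarrow> real" where
  "average_allocation n F u T b i j = (1 / real T) * (\<Sum>t<T. allocation n F u (b t) i j)"

definition deviation_utility ::
  "nat \<Rightarrow> ((nat \<Rightarrow> nat \<Rightarrow> real) \<Rightarrow> ereal) \<Rightarrow> (nat \<Rightarrow> nat \<Rightarrow> real) \<Rightarrow> nat \<Rightarrow>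
   (nat \<Rightarrow> nat \<Rightarrow> real) \<Rightarrow> nat \<Rightarrow> (nat \<Rightarrow> real) \<Rightarrow> real" where
  "deviation_utility n F u T b i s = (\<Sum>t<T. utility n F u i ((b t)(i := s t)))"

definition deviation_payment ::
  "nat \<Rightarrow> ((nat \<Rightarrow> nat \<Rightarrow> real) \<Rightarrow> ereal) \<Rightarrow> (nat \<Rightarrow> nat \<Rightarrow> real) \<Rightarrow> nat \<Rightarrow>
   (nat \<Rightarrow> nat \<Rightarrow> real) \<Rightarrow> nat \<Rightarrow> (nat \<Rightarrow> real) \<Rightarrow> real" where
  "deviation_payment n F u T b i s = (\<Sum>t<T. payment n F u i ((b t)(i := s t)))"

text \<open>
  Randomized bid sequences are arbitrary Borel probability measures on the cube \<open>[0,L]\<^sup>T\<close>.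
  They need not be product measures: bids of different rounds may be correlated.
\<close>

definition affordable_strategies ::
  "nat \<Rightarrow> ((nat \<Rightarrow> nat \<Rightarrow> real) \<Rightarrow> ereal) \<Rightarrow> (nat \<Rightarrow> nat \<Rightarrow> real) \<Rightarrow> real \<Rightarrow> nat \<Rightarrow>
   (nat \<Rightarrow> nat \<Rightarrow> real) \<Rightarrow> nat \<Rightarrow> (nat \<Rightarrow> real) measure set" where
  "affordable_strategies n F u L T b i = {M.
     prob_space M \<and>
     sets M = sets (PiM {..<T} (\<lambda>_. restrict_space borel {0..L})) \<and>
     integral\<^sup>L M (deviation_payment n F u T b i) \<le> real T}"

definition strong_regret ::
  "nat \<Rightarrow> ((nat \<Rightarrow> nat \<Rightarrow> real) \<Rightarrow> ereal) \<Rightarrow> (nat \<Rightarrow> nat \<Rightarrow> real) \<Rightarrow> real \<Rightarrow> nat \<Rightarrow>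
   (nat \<Rightarrow> nat \<Rightarrow> real) \<Rightarrow> nat \<Rightarrow> ereal" where
  "strong_regret n F u L T b i =
     (SUP M\<in>affordable_strategies n F u L T b i.
        ereal (integral\<^sup>L M (deviation_utility n F u T b i) - (\<Sum>t<T. utility n F u i (b t))))"

definition best_response_sequence ::
  "nat \<Rightarrow> ((nat \<Rightarrow> nat \<Rightarrow> real) \<Rightarrow> ereal) \<Rightarrow> (nat \<Rightarrow> nat \<Rightarrow> real) \<Rightarrow> nat \<Rightarrow>
   (nat \<Rightarrow> nat \<Rightarrow> real) \<Rightarrow> nat \<Rightarrow> nat \<Rightarrow> real" where
  "best_response_sequence n F u T b i =
     (THE s. is_arg_max (deviation_utility n F u T b i)
               (\<lambda>s. s \<in> {..<T} \<rightarrow>\<^sub>E {0..} \<and> deviation_payment n F u T b i s \<le> real T) s)"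

definition best_response ::
  "nat \<Rightarrow> ((nat \<Rightarrow> nat \<Rightarrow> real) \<Rightarrow> ereal) \<Rightarrow> (nat \<Rightarrow> nat \<Rightarrow> real) \<Rightarrow> real \<Rightarrow> nat \<Rightarrow>
   (nat \<Rightarrow> nat \<Rightarrow> real) \<Rightarrow> nat \<Rightarrow> real" where
  "best_response n F u L T b i =
     min (THE v. \<forall>t<T. best_response_sequence n F u T b i t = v) L"


subsection \<open>VCG prices and approximate competitive equilibria\<close>

definition vcg_opt :: "nat \<Rightarrow> (nat \<Rightarrow> nat \<Rightarrow> real) \<Rightarrow> real" where
  "vcg_opt n v = Max ((\<lambda>\<pi>. \<Sum>i<n. v i (\<pi> i)) ` {\<pi>. \<pi> permutes {..<n}})"

text \<open>The additional index \<open>n\<close> stands for the second copy of item \<open>j\<close>.\<close>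

definition vcg_opt_plus :: "nat \<Rightarrow> (nat \<Rightarrow> nat \<Rightarrow> real) \<Rightarrow> nat \<Rightarrow> real" where
  "vcg_opt_plus n v j =
     Max ((\<lambda>\<pi>. \<Sum>i<n. v i (if \<pi> i = n then j else \<pi> i)) `
       {\<pi> \<in> {..<n} \<rightarrow>\<^sub>E {..n}. inj_on \<pi> {..<n}})"

definition vcg_price :: "nat \<Rightarrow> (nat \<Rightarrow> nat \<Rightarrow> real) \<Rightarrow> nat \<Rightarrow> real" where
  "vcg_price n v j = vcg_opt_plus n v j - vcg_opt n v"

definition competitive_equilibrium ::
  "nat \<Rightarrow> (nat \<Rightarrow> nat \<Rightarrow> real) \<Rightarrow> real \<Rightarrow> (nat \<Rightarrow> real) \<Rightarrow> (nat \<Rightarrow> nat \<Rightarrow> real) \<Rightarrow> bool" where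
  "competitive_equilibrium n u \<delta> p x \<longleftrightarrow>
     x \<in> bistochastic n \<and>
     (\<forall>i<n. (\<Sum>j<n. p j * x i j) \<le> 1 \<and>
       (\<forall>y :: nat \<Rightarrow> real.
          (\<forall>j<n. y j \<ge> 0) \<longrightarrow> (\<Sum>j<n. y j) = 1 \<longrightarrow> (\<Sum>j<n. p j * y j) \<le> 1 \<longrightarrow>
          (\<Sum>j<n. u i j * y j) \<le> (\<Sum>j<n. u i j * x i j) + \<delta>))"

end

theory Submission
  imports Defs
begin

text \<open>
  The value \<open>\<Phi>(\<lambda>) = OPT\<^sub>0(\<lambda>)\<close> is convex with partial derivatives \<open>U\<^sub>i\<close>, so
  \<open>a U\<^sub>i - P\<^sub>i\<close> is maximized by the bid \<open>a\<close>, and the loss of any other bid is a Bregman divergence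
  of \<open>\<Phi>\<close>. Summed over the rounds, these losses are at most \<open>L \<epsilon> T\<close> by low regret against the
  constant best response. Perturbing the optimal allocation by a \<open>2 \<times> 2\<close> swap shows that they are at
  least quadratic in the distance of the bids, so the bids are close to the best responses in most
  rounds.

  The barrier changes the optimal welfare by at most \<open>2 / L\<close>. Hence the average allocation almost
  attains the value of the dual solution formed by the VCG prices and the marginal contributions of
  the players. Approximate complementary slackness then bounds the expenditure of each player at the
  VCG prices by her payment, up to \<open>O(1 / L)\<close>, and shows that her bundle is almost optimal among
  the affordable ones: her budget is exhausted, or else her best response is capped at \<open>L\<close> and
  money matters little.
\<close>

text \<open>The image of \<open>A - {i}\<close> has fewer elements than \<open>A\<close>, so a value
  is left over for \<open>i\<close>. This turns an assignment of the other players into a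
  permutation.\<close>

lemma permutes_extend:
  assumes "finite A" "i \<in> A" "inj_on f (A - {i})" "f ` (A - {i}) \<subseteq> A"
  obtains p where "p permutes A" "\<And>k. k \<in> A - {i} \<Longrightarrow> p k = f k"
proof -
  have "card (f ` (A - {i})) < card A"
    using assms card_gt_0_iff[of A] by (auto simp: card_image)
  then obtain r where r: "r \<in> A" "r \<notin> f ` (A - {i})"
    by (metis assms(1,4) nless_le subsetI subset_antisym)
  define p where "p = (\<lambda>k. if k \<in> A then (f(i := r)) k else k)"
  have "inj_on p A"
    using assms(3) r by (auto simp: p_def inj_on_def)
  moreover have "p ` A \<subseteq> A"
    using r assms(4) by (auto simp: p_def)
  ultimately have "bij_betw p A A"
    using assms(1) by (simp add: bij_betw_def endo_inj_surj)
  then have "p permutes A"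
    by (rule bij_imp_permutes) (simp add: p_def)
  then show ?thesis
    by (rule that) (auto simp: p_def)
qed

section \<open>Duality for VCG prices\<close>

lemma vcg_opt_ge:
  assumes "\<pi> permutes {..<n}"
  shows "(\<Sum>i<n. v i (\<pi> i)) \<le> vcg_opt n v"
  unfolding vcg_opt_def using assms by (intro Max_ge) (auto simp: finite_permutations)

lemma vcg_opt_attained:
  obtains \<pi> where "\<pi> permutes {..<n}" "vcg_opt n v = (\<Sum>i<n. v i (\<pi> i))"
proof -
  have "vcg_opt n v \<in> (\<lambda>\<pi>. \<Sum>i<n. v i (\<pi> i)) ` {\<pi>. \<pi> permutes {..<n}}"
    unfolding vcg_opt_def
    by (intro Max_in) (auto simp: finite_permutations intro: permutes_id)
  then show ?thesis using that by auto
qed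

lemma finite_injections: "finite {\<pi> \<in> {..<n::nat} \<rightarrow>\<^sub>E {..n}. inj_on \<pi> {..<n}}"
  by (rule finite_subset[of _ "{..<n} \<rightarrow>\<^sub>E {..n}"]) (auto intro: finite_PiE)

lemma vcg_opt_plus_ge:
  assumes "\<And>i. i < n \<Longrightarrow> \<pi> i \<le> n" "inj_on \<pi> {..<n}"
  shows "(\<Sum>i<n. v i (if \<pi> i = n then j else \<pi> i)) \<le> vcg_opt_plus n v j"
proof -
  let ?g = "\<lambda>\<pi>. \<Sum>i<n. v i (if \<pi> i = n then j else \<pi> i)"
  have "?g \<pi> = ?g (restrict \<pi> {..<n})" by (intro sum.cong) auto
  also have "\<dots> \<le> vcg_opt_plus n v j"
    unfolding vcg_opt_plus_def
    by (intro Max_ge finite_imageI finite_injections imageI,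
      unfold mem_Collect_eq restrict_PiE_iff inj_on_restrict_eq) (use assms in auto)
  finally show ?thesis .
qed

lemma vcg_opt_plus_attained:
  obtains \<pi> where "\<And>i. i < n \<Longrightarrow> \<pi> i \<le> n" "inj_on \<pi> {..<n}"
    "vcg_opt_plus n v j = (\<Sum>i<n. v i (if \<pi> i = n then j else \<pi> i))"
proof -
  have "restrict id {..<n} \<in> {\<pi> \<in> {..<n} \<rightarrow>\<^sub>E {..n}. inj_on \<pi> {..<n}}"
    by (unfold mem_Collect_eq restrict_PiE_iff inj_on_restrict_eq) auto
  then have "vcg_opt_plus n v j \<in> (\<lambda>\<pi>. \<Sum>i<n. v i (if \<pi> i = n then j else \<pi> i)) `
       {\<pi> \<in> {..<n} \<rightarrow>\<^sub>E {..n}. inj_on \<pi> {..<n}}"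
    unfolding vcg_opt_plus_def
    by (intro Max_in finite_imageI finite_injections) blast
  then obtain \<pi> where "\<pi> \<in> {..<n} \<rightarrow>\<^sub>E {..n}" "inj_on \<pi> {..<n}"
    "vcg_opt_plus n v j = (\<Sum>i<n. v i (if \<pi> i = n then j else \<pi> i))" by auto
  then show ?thesis by (intro that[of \<pi>]) auto
qed

text \<open>An optimal permutation never takes the index \<open>n\<close>, so it stays admissible
  when the second copy is added.\<close>

lemma vcg_price_nonneg:
  assumes "j < n"
  shows "0 \<le> vcg_price n v j"
proof -
  obtain \<pi> where \<pi>: "\<pi> permutes {..<n}" "vcg_opt n v = (\<Sum>i<n. v i (\<pi> i))"
    by (rule vcg_opt_attained)
  have lt: "\<pi> i < n" if "i < n" for i
    using permutes_in_image[OF \<pi>(1)] that by auto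
  have "(\<Sum>i<n. v i (\<pi> i)) = (\<Sum>i<n. v i (if \<pi> i = n then j else \<pi> i))"
    using lt by (intro sum.cong) (auto dest: less_imp_neq)
  also have "\<dots> \<le> vcg_opt_plus n v j"
    using lt by (intro vcg_opt_plus_ge permutes_inj_on[OF \<pi>(1)]) (auto intro: less_imp_le)
  finally show ?thesis by (simp add: vcg_price_def \<pi>(2))
qed

text \<open>The dual variable of row \<open>i\<close> in the assignment problem, with the VCG prices
  as column variables. Absence of \<open>i\<close> is encoded by a zero row: she still takes an
  item, but the other \<open>n - 1\<close> players can always leave one over.\<close>

definition marginal :: "nat \<Rightarrow> (nat \<Rightarrow> nat \<Rightarrow> real) \<Rightarrow> nat \<Rightarrow> real" where
  "marginal n v i = vcg_opt n v - vcg_opt n (v(i := \<lambda>_. 0))"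

text \<open>Dual feasibility: after an optimal assignment of the others without \<open>i\<close>,
  she can be given the second copy of \<open>j\<close>, which has the index
  \<open>n\<close>.\<close>

lemma marginal_price_covers:
  assumes "i < n" "j < n"
  shows "v i j \<le> marginal n v i + vcg_price n v j"
proof -
  obtain \<pi> where \<pi>: "\<pi> permutes {..<n}"
    "vcg_opt n (v(i := \<lambda>_. 0)) = (\<Sum>k<n. (v(i := \<lambda>_. 0)) k (\<pi> k))"
    by (rule vcg_opt_attained)
  have lt: "\<pi> k < n" if "k < n" for k
    using permutes_in_image[OF \<pi>(1)] that by auto
  have inj: "inj_on (\<pi>(i := n)) {..<n}"
    using permutes_inj_on[OF \<pi>(1)] lt by (auto simp: inj_on_def)
  have "vcg_opt n (v(i := \<lambda>_. 0)) = (\<Sum>k\<in>{..<n}-{i}. v k (\<pi> k))"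
    using assms(1) \<pi>(2) by (simp add: sum.remove[of "{..<n}" i])
  moreover have "(\<Sum>k<n. v k (if (\<pi>(i := n)) k = n then j else (\<pi>(i := n)) k)) =
      v i j + (\<Sum>k\<in>{..<n}-{i}. v k (\<pi> k))"
    using assms(1) lt
    by (simp add: sum.remove[of "{..<n}" i]) (intro sum.cong, auto dest: less_imp_neq)
  moreover have "(\<Sum>k<n. v k (if (\<pi>(i := n)) k = n then j else (\<pi>(i := n)) k)) \<le> vcg_opt_plus n v j"
    using lt by (intro vcg_opt_plus_ge inj) (auto intro: less_imp_le)
  ultimately show ?thesis by (simp add: marginal_def vcg_price_def)
qed

text \<open>
  Exchange argument: an optimal assignment \<open>\<sigma>\<close> with a second copy of \<open>\<pi> i\<close> and an optimal \<open>\<pi>\<close>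
  without it are interchanged on the \<open>\<pi>\<inverse> \<circ> \<sigma>\<close>-orbit of \<open>i\<close>. The orbit is a cycle, since only
  \<open>i\<close> can have two preimages.
\<close>

lemma marginal_price_tight:
  assumes i: "i < n" and \<pi>: "\<pi> permutes {..<n}" and opt: "vcg_opt n v = (\<Sum>k<n. v k (\<pi> k))"
  shows "marginal n v i + vcg_price n v (\<pi> i) \<le> v i (\<pi> i)"
proof -
  define j where "j = \<pi> i"
  have lt: "\<pi> k < n \<longleftrightarrow> k < n" for k
    using permutes_in_image[OF \<pi>] by auto
  have jn: "j < n" using lt i by (simp add: j_def)
  obtain \<sigma>0 where \<sigma>0: "\<And>i. i < n \<Longrightarrow> \<sigma>0 i \<le> n" "inj_on \<sigma>0 {..<n}"
    "vcg_opt_plus n v j = (\<Sum>i<n. v i (if \<sigma>0 i = n then j else \<sigma>0 i))"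
    using vcg_opt_plus_attained[where n = n and v = v and j = j] by blast
  define \<sigma> where "\<sigma> = (\<lambda>k. if \<sigma>0 k = n then j else \<sigma>0 k)"
  have \<sigma>lt: "\<sigma> k < n" if "k < n" for k
    using \<sigma>0(1)[OF that] jn by (auto simp: \<sigma>_def)
  have coll: "\<sigma> k = j" if "k < n" "k' < n" "k \<noteq> k'" "\<sigma> k = \<sigma> k'" for k k'
    using that \<sigma>0(2) by (auto simp: \<sigma>_def inj_on_def split: if_splits)
  \<comment> \<open>\<open>\<sigma>\<close> takes \<open>j\<close> only through the values
    \<open>j\<close> and \<open>n\<close> of the injective \<open>\<sigma>0\<close>, hence at most
    twice.\<close>
  have coll3: "k1 = k2 \<or> k1 = k3 \<or> k2 = k3"
    if "k1 < n" "k2 < n" "k3 < n" "\<sigma> k1 = j" "\<sigma> k2 = j" "\<sigma> k3 = j" for k1 k2 k3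
    using that \<sigma>0(2) unfolding \<sigma>_def inj_on_def by (metis lessThan_iff)
  define \<phi> where "\<phi> = inv \<pi> \<circ> \<sigma>"
  have \<pi>\<phi>: "\<pi> (\<phi> k) = \<sigma> k" for k
    using permutes_inverses[OF \<pi>] by (simp add: \<phi>_def)
  have \<phi>lt: "\<phi> k < n" if "k < n" for k
    using \<pi>\<phi> lt \<sigma>lt[OF that] by metis
  define S where "S = range (\<lambda>m. (\<phi> ^^ m) i)"
  have Sn: "S \<subseteq> {..<n}"
  proof -
    have "(\<phi> ^^ m) i < n" for m by (induction m) (auto simp: i \<phi>lt)
    then show ?thesis by (auto simp: S_def)
  qed
  then have finS: "finite S" by (rule finite_subset) simp
  have iS: "i \<in> S" unfolding S_def by (rule range_eqI[of _ _ 0]) simp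
  have \<phi>S: "\<phi> ` S \<subseteq> S"
  proof -
    have "\<phi> ((\<phi> ^^ m) i) \<in> S" for m
      unfolding S_def by (rule range_eqI[of _ _ "Suc m"]) simp
    then show ?thesis by (auto simp: S_def)
  qed
  \<comment> \<open>Otherwise \<open>\<phi>\<close> maps the finite set \<open>S\<close> into
    \<open>S - {i}\<close>, so two players collide. Collisions of \<open>\<sigma>\<close> occur only
    at \<open>j = \<pi> i\<close>, which puts \<open>i\<close> into the image after all.\<close>
  have "i \<in> \<phi> ` S"
  proof (rule ccontr)
    assume ni: "i \<notin> \<phi> ` S"
    have "\<not> inj_on \<phi> S"
      using ni iS \<phi>S finS endo_inj_surj by blast
    then obtain k k' where k: "k \<in> S" "k' \<in> S" "k \<noteq> k'" "\<phi> k = \<phi> k'"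
      unfolding inj_on_def by blast
    have "\<sigma> k = \<sigma> k'" using k(4) \<pi>\<phi>[of k] \<pi>\<phi>[of k'] by simp
    then have "\<sigma> k = j" using coll[of k k'] k Sn by auto
    then have "\<phi> k = i" using permutes_inverses[OF \<pi>] by (simp add: \<phi>_def j_def)
    then show False using ni k by blast
  qed
  then have "S \<subseteq> \<phi> ` S"
  proof -
    have "(\<phi> ^^ m) i \<in> \<phi> ` S" for m
      using \<open>i \<in> \<phi> ` S\<close> by (cases m) (auto simp: S_def)
    then show ?thesis by (auto simp: S_def)
  qed
  with \<phi>S have \<phi>SS: "\<phi> ` S = S" by blast
  have inj\<phi>: "inj_on \<phi> S" using finS \<phi>SS by (simp add: eq_card_imp_inj_on)
  have img: "\<sigma> ` S = \<pi> ` S"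
  proof -
    have "\<sigma> = \<pi> \<circ> \<phi>" using \<pi>\<phi> by auto
    then have "\<sigma> ` S = \<pi> ` (\<phi> ` S)" by (simp only: image_comp)
    then show ?thesis by (simp only: \<phi>SS)
  qed
  have inj\<sigma>: "inj_on \<sigma> S"
    using inj\<phi> by (auto simp: inj_on_def \<phi>_def)
  have inj\<pi>: "inj \<pi>" using permutes_inj[OF \<pi>] .
  obtain k0 where k0: "k0 \<in> S" "\<sigma> k0 = j"
  proof -
    have "j \<in> \<sigma> ` S" unfolding img j_def using iS by (rule imageI)
    then show ?thesis using that by auto
  qed
  have inj\<sigma>': "inj_on \<sigma> ({..<n} - S)"
  proof (rule inj_onI, rule ccontr)
    fix k k' assume k: "k \<in> {..<n} - S" "k' \<in> {..<n} - S" "\<sigma> k = \<sigma> k'" "k \<noteq> k'"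
    then have "\<sigma> k = j" using coll[of k k'] by auto
    then show False using coll3[of k k' k0] k k0 Sn by auto
  qed
  \<comment> \<open>Every item that \<open>\<pi>\<close> uses on the orbit is used there by
    \<open>\<sigma>\<close> as well. A further use outside the orbit forces the item
    \<open>j\<close>, which \<open>\<pi>\<close> gives to \<open>i\<close> alone.\<close>
  have sep: "\<sigma> k \<noteq> \<pi> k'" if "k \<in> {..<n} - S" "k' \<in> S - {i}" for k k'
  proof
    assume e: "\<sigma> k = \<pi> k'"
    have "\<pi> k' \<in> \<sigma> ` S" unfolding img using that by blast
    then obtain k2 where k2: "k2 \<in> S" "\<sigma> k2 = \<pi> k'" by auto
    then have "\<sigma> k = j" using coll[of k k2] e that Sn by auto
    then have "\<pi> k' = \<pi> i" using e by (simp add: j_def)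
    then show False using that inj\<pi> by (auto dest: injD)
  qed
  \<comment> \<open>First result of the interchange: a permutation, because both assignments use the
    same items on \<open>S\<close>.\<close>
  define \<pi>' where "\<pi>' = (\<lambda>k. if k \<in> S then \<sigma> k else \<pi> k)"
  have "\<pi>' permutes {..<n}"
  proof (rule bij_imp_permutes)
    have "inj_on \<pi>' {..<n}"
    proof (rule inj_onI)
      fix k k' assume kk: "k \<in> {..<n}" "k' \<in> {..<n}" "\<pi>' k = \<pi>' k'"
      have mix: False if "a \<in> S" "b \<notin> S" "\<sigma> a = \<pi> b" for a b
      proof -
        have "\<pi> b \<in> \<pi> ` S" unfolding img[symmetric] using that by (metis imageI)
        then show False using that inj\<pi> by (auto dest: injD)
      qed
      show "k = k'"
      proof (cases "k \<in> S"; cases "k' \<in> S")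
        assume "k \<in> S" "k' \<in> S"
        then show ?thesis using kk(3) inj_onD[OF inj\<sigma>] by (simp add: \<pi>'_def)
      next
        assume "k \<in> S" "k' \<notin> S"
        then show ?thesis using kk(3) mix[of k k'] by (simp add: \<pi>'_def)
      next
        assume "k \<notin> S" "k' \<in> S"
        then show ?thesis using kk(3) mix[of k' k] by (simp add: \<pi>'_def)
      next
        assume "k \<notin> S" "k' \<notin> S"
        then show ?thesis using kk(3) injD[OF inj\<pi>] by (simp add: \<pi>'_def)
      qed
    qed
    moreover have "\<pi>' ` {..<n} \<subseteq> {..<n}"
      using \<sigma>lt lt by (auto simp: \<pi>'_def)
    ultimately show "bij_betw \<pi>' {..<n} {..<n}"
      by (simp add: bij_betw_def endo_inj_surj)
    show "\<pi>' x = x" if "x \<notin> {..<n}" for x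
      using that Sn permutes_not_in[OF \<pi>] by (auto simp: \<pi>'_def)
  qed
  then have 1: "(\<Sum>k<n. v k (\<pi>' k)) \<le> (\<Sum>k<n. v k (\<pi> k))"
    using vcg_opt_ge opt by metis
  \<comment> \<open>Second result: it gives \<open>j\<close> to \<open>i\<close> and is injective on
    the other players, so it competes in the market without \<open>i\<close>.\<close>
  define \<sigma>' where "\<sigma>' = (\<lambda>k. if k \<in> S then \<pi> k else \<sigma> k)"
  have "inj_on \<sigma>' ({..<n} - {i})"
  proof (rule inj_onI)
    fix k k' assume kk: "k \<in> {..<n} - {i}" "k' \<in> {..<n} - {i}" "\<sigma>' k = \<sigma>' k'"
    show "k = k'"
    proof (cases "k \<in> S"; cases "k' \<in> S")
      assume "k \<in> S" "k' \<in> S"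
      then show ?thesis using kk(3) injD[OF inj\<pi>] by (simp add: \<sigma>'_def)
    next
      assume "k \<in> S" "k' \<notin> S"
      then show ?thesis using kk sep[of k' k] by (simp add: \<sigma>'_def)
    next
      assume "k \<notin> S" "k' \<in> S"
      then show ?thesis using kk sep[of k k'] by (simp add: \<sigma>'_def)
    next
      assume "k \<notin> S" "k' \<notin> S"
      then show ?thesis using kk inj_onD[OF inj\<sigma>', of k k'] by (simp add: \<sigma>'_def)
    qed
  qed
  moreover have "\<sigma>' ` ({..<n} - {i}) \<subseteq> {..<n}"
    using \<sigma>lt lt by (auto simp: \<sigma>'_def)
  ultimately obtain p where p: "p permutes {..<n}" "\<And>k. k \<in> {..<n} - {i} \<Longrightarrow> p k = \<sigma>' k"
    using permutes_extend[of "{..<n}" i \<sigma>'] i by auto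
  have "(\<Sum>k<n. (v(i := \<lambda>_. 0)) k (p k)) = (\<Sum>k\<in>{..<n}-{i}. v k (\<sigma>' k))"
    using i by (simp add: sum.remove[of "{..<n}" i] p(2))
  then have 2: "(\<Sum>k\<in>{..<n}-{i}. v k (\<sigma>' k)) \<le> vcg_opt n (v(i := \<lambda>_. 0))"
    using vcg_opt_ge[OF p(1)] by metis
  have 3: "(\<Sum>k<n. v k (\<sigma>' k)) = v i j + (\<Sum>k\<in>{..<n}-{i}. v k (\<sigma>' k))"
    using i iS by (subst sum.remove[of "{..<n}" i]) (auto simp: \<sigma>'_def j_def)
  have "(\<Sum>k<n. v k (\<sigma>' k)) + (\<Sum>k<n. v k (\<pi>' k)) = (\<Sum>k<n. v k (\<sigma> k)) + (\<Sum>k<n. v k (\<pi> k))"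
    unfolding sum.distrib[symmetric] by (intro sum.cong) (auto simp: \<sigma>'_def \<pi>'_def)
  moreover have "(\<Sum>k<n. v k (\<sigma> k)) = vcg_opt_plus n v j"
    using \<sigma>0(3) by (simp add: \<sigma>_def)
  ultimately show ?thesis
    using 1 2 3 by (simp add: marginal_def vcg_price_def j_def)
qed

text \<open>Tightness is summed along an optimal permutation, which meets each item once. Together
  with \<open>marginal_price_covers\<close>, the marginals and prices form an optimal dual
  solution.\<close>

lemma marginal_price_sum_le:
  "(\<Sum>i<n. marginal n v i) + (\<Sum>j<n. vcg_price n v j) \<le> vcg_opt n v"
proof -
  obtain \<pi> where \<pi>: "\<pi> permutes {..<n}" "vcg_opt n v = (\<Sum>i<n. v i (\<pi> i))"
    by (rule vcg_opt_attained)
  have "(\<Sum>j<n. vcg_price n v j) = (\<Sum>i<n. vcg_price n v (\<pi> i))"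
    using sum.permute[OF \<pi>(1)] by (simp add: comp_def)
  then have "(\<Sum>i<n. marginal n v i) + (\<Sum>j<n. vcg_price n v j) =
      (\<Sum>i<n. marginal n v i + vcg_price n v (\<pi> i))"
    by (simp add: sum.distrib)
  also have "\<dots> \<le> (\<Sum>i<n. v i (\<pi> i))"
    by (intro sum_mono marginal_price_tight \<pi>) auto
  finally show ?thesis using \<pi>(2) by simp
qed

section \<open>The regularized objective\<close>

text \<open>
  The \<^typ>\<open>ereal\<close>-valued objective equals \<open>gain l\<close> on matrices with positive entries and \<open>-\<infinity>\<close> on
  all others.
\<close>

locale regularized =
  fixes n :: nat and u :: "nat \<Rightarrow> nat \<Rightarrow> real" and \<beta> :: real
  assumes n_pos: "0 < n" and \<beta>_pos: "0 < \<beta>"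
    and u_range: "\<And>i j. i < n \<Longrightarrow> j < n \<Longrightarrow> u i j \<in> {0..1}"
begin

abbreviation F :: "(nat \<Rightarrow> nat \<Rightarrow> real) \<Rightarrow> ereal" where
  "F \<equiv> separable_regularizer n (inverse_barrier \<beta>)"

definition score :: "nat \<Rightarrow> (nat \<Rightarrow> nat \<Rightarrow> real) \<Rightarrow> real" where
  "score i x = (\<Sum>j<n. u i j * x i j)"

definition cost :: "(nat \<Rightarrow> nat \<Rightarrow> real) \<Rightarrow> real" where
  "cost x = (\<Sum>i<n. \<Sum>j<n. \<beta> / x i j)"

definition welfare :: "(nat \<Rightarrow> real) \<Rightarrow> (nat \<Rightarrow> nat \<Rightarrow> real) \<Rightarrow> real" where
  "welfare l x = (\<Sum>k<n. l k * score k x)"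

definition gain :: "(nat \<Rightarrow> real) \<Rightarrow> (nat \<Rightarrow> nat \<Rightarrow> real) \<Rightarrow> real" where
  "gain l x = welfare l x - cost x"

definition pos_bistochastic :: "(nat \<Rightarrow> nat \<Rightarrow> real) set" where
  "pos_bistochastic = {x \<in> bistochastic n. \<forall>i<n. \<forall>j<n. 0 < x i j}"

definition uniform :: "nat \<Rightarrow> nat \<Rightarrow> real" where
  "uniform = (\<lambda>k j. if k < n \<and> j < n then 1 / real n else 0)"

abbreviation x :: "(nat \<Rightarrow> real) \<Rightarrow> nat \<Rightarrow> nat \<Rightarrow> real" where "x \<equiv> allocation n F u"
abbreviation \<Phi> :: "(nat \<Rightarrow> real) \<Rightarrow> real" where "\<Phi> \<equiv> opt0 n F u"
abbreviation U :: "nat \<Rightarrow> (nat \<Rightarrow> real) \<Rightarrow> real" where "U \<equiv> utility n F u"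
abbreviation P :: "nat \<Rightarrow> (nat \<Rightarrow> real) \<Rightarrow> real" where "P \<equiv> payment n F u"

lemma bistochasticD:
  assumes "y \<in> bistochastic n"
  shows "i < n \<Longrightarrow> j < n \<Longrightarrow> 0 \<le> y i j" "i < n \<Longrightarrow> j < n \<Longrightarrow> y i j \<le> 1"
    "i < n \<Longrightarrow> (\<Sum>j<n. y i j) = 1" "j < n \<Longrightarrow> (\<Sum>i<n. y i j) = 1"
    "\<not> (i < n \<and> j < n) \<Longrightarrow> y i j = 0"
  using assms unfolding bistochastic_def by auto

lemma bistochasticI:
  assumes "\<And>i j. i < n \<Longrightarrow> j < n \<Longrightarrow> 0 \<le> y i j"
    "\<And>i. i < n \<Longrightarrow> (\<Sum>j<n. y i j) = 1" "\<And>j. j < n \<Longrightarrow> (\<Sum>i<n. y i j) = 1"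
    "\<And>i j. \<not> (i < n \<and> j < n) \<Longrightarrow> y i j = 0"
  shows "y \<in> bistochastic n"
proof -
  have "y i j \<le> 1" if "i < n" "j < n" for i j
    using member_le_sum[of j "{..<n}" "y i"] assms(1,2) that by auto
  then show ?thesis using assms unfolding bistochastic_def by auto
qed

lemma pos_bistochasticD:
  assumes "y \<in> pos_bistochastic"
  shows "y \<in> bistochastic n" "i < n \<Longrightarrow> j < n \<Longrightarrow> 0 < y i j"
  using assms unfolding pos_bistochastic_def by auto

lemma uniform_bistochastic: "uniform \<in> pos_bistochastic"
  unfolding pos_bistochastic_def using n_pos
  by (auto intro!: bistochasticI simp: uniform_def split: if_splits)

lemma bistochastic_mix:
  assumes "y \<in> bistochastic n" "z \<in> bistochastic n" "0 \<le> \<theta>" "\<theta> \<le> 1"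
  shows "(\<lambda>i j. (1 - \<theta>) * y i j + \<theta> * z i j) \<in> bistochastic n"
  using assms(3,4)
  by (intro bistochasticI)
    (auto simp: bistochasticD[OF assms(1)] bistochasticD[OF assms(2)] sum.distrib
      simp flip: sum_distrib_left)

lemma score_range:
  assumes "y \<in> bistochastic n" "i < n"
  shows "0 \<le> score i y" "score i y \<le> 1"
proof -
  show "0 \<le> score i y" unfolding score_def
    using u_range assms by (intro sum_nonneg mult_nonneg_nonneg) (auto simp: bistochasticD)
  have "score i y \<le> (\<Sum>j<n. y i j)" unfolding score_def
    using u_range assms by (intro sum_mono mult_left_le_one_le) (auto simp: bistochasticD)
  then show "score i y \<le> 1" using assms by (simp add: bistochasticD)
qed

lemma cost_nonneg:
  assumes "y \<in> bistochastic n"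
  shows "0 \<le> cost y"
  unfolding cost_def using assms \<beta>_pos
  by (intro sum_nonneg divide_nonneg_nonneg) (auto simp: bistochasticD)

lemma cost_le:
  assumes "0 < m" "\<And>i j. i < n \<Longrightarrow> j < n \<Longrightarrow> m \<le> y i j"
  shows "cost y \<le> real n ^ 2 * \<beta> / m"
proof -
  have "cost y \<le> (\<Sum>i<n. \<Sum>j<n. \<beta> / m)"
    unfolding cost_def using assms \<beta>_pos by (intro sum_mono divide_left_mono mult_pos_pos) (auto intro: less_le_trans)
  then show ?thesis by (simp add: power2_eq_square)
qed

lemma cost_ge_entry:
  assumes "y \<in> bistochastic n" "i < n" "j < n"
  shows "\<beta> / y i j \<le> cost y"
proof -
  have nn: "0 \<le> \<beta> / y i j" if "i < n" "j < n" for i j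
    using bistochasticD(1)[OF assms(1) that] \<beta>_pos by simp
  have "\<beta> / y i j \<le> (\<Sum>j<n. \<beta> / y i j)"
    using assms nn by (intro member_le_sum) auto
  also have "\<dots> \<le> cost y"
    unfolding cost_def using assms nn
    by (intro member_le_sum[where f = "\<lambda>i. \<Sum>j<n. \<beta> / y i j"] sum_nonneg) auto
  finally show ?thesis .
qed

lemma welfare_diff: "welfare l' y - welfare l y = (\<Sum>k<n. (l' k - l k) * score k y)"
  by (simp add: welfare_def algebra_simps sum_subtractf)

text \<open>The cost does not depend on the bids and cancels, so the bound is uniform in
  \<open>\<beta>\<close>.\<close>

lemma gain_diff_le:
  assumes "y \<in> bistochastic n"
  shows "\<bar>gain l' y - gain l y\<bar> \<le> (\<Sum>k<n. \<bar>l' k - l k\<bar>)"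
proof -
  have "\<bar>gain l' y - gain l y\<bar> = \<bar>\<Sum>k<n. (l' k - l k) * score k y\<bar>"
    by (simp add: gain_def flip: welfare_diff)
  also have "\<dots> \<le> (\<Sum>k<n. \<bar>(l' k - l k) * score k y\<bar>)" by (rule sum_abs)
  also have "\<dots> \<le> (\<Sum>k<n. \<bar>l' k - l k\<bar>)"
    using score_range[OF assms] by (intro sum_mono) (simp add: abs_mult mult_left_le)
  finally show ?thesis .
qed

lemma welfare_upd:
  assumes "i < n"
  shows "welfare (l(i := a)) y = welfare l y + (a - l i) * score i y"
proof -
  have "welfare (l(i := a)) y - welfare l y = (a - l i) * score i y"
    unfolding welfare_diff using assms by (simp add: sum.remove[of "{..<n}" i])
  then show ?thesis by simp
qed

lemma gain_upd:
  assumes "i < n"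
  shows "gain (l(i := a)) y = gain l y + (a - l i) * score i y"
  by (simp add: gain_def welfare_upd[OF assms])

lemma objective_pos:
  assumes "y \<in> pos_bistochastic"
  shows "objective n F u l y = ereal (gain l y)"
proof -
  have "F y = (\<Sum>i<n. \<Sum>j<n. ereal (- \<beta> / y i j))"
    unfolding separable_regularizer_def inverse_barrier_def
    by (intro sum.cong) (auto dest: pos_bistochasticD(2)[OF assms])
  also have "\<dots> = ereal (- cost y)"
    by (simp add: cost_def sum_negf)
  finally show ?thesis
    by (simp add: objective_def gain_def welfare_def score_def sum_distrib_left mult.assoc)
qed

lemma objective_not_pos:
  assumes "y \<in> bistochastic n" "y \<notin> pos_bistochastic"
  shows "objective n F u l y = -\<infinity>"
proof -
  obtain i j where ij: "i < n" "j < n" "y i j = 0"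
    using assms bistochasticD(1)[OF assms(1)] unfolding pos_bistochastic_def
    by (auto simp: not_less) (meson antisym)
  \<comment> \<open>In \<open>ereal\<close>, adding \<open>\<infinity>\<close> to
    \<open>-\<infinity>\<close> gives \<open>\<infinity>\<close>. Only after excluding
    \<open>\<infinity>\<close> can a single \<open>-\<infinity>\<close> absorb the rest of the
    sum.\<close>
  have np: "inverse_barrier \<beta> (y i j) \<noteq> \<infinity>" for i j by (simp add: inverse_barrier_def)
  have np2: "(\<Sum>j<n. inverse_barrier \<beta> (y i j)) \<noteq> \<infinity>" for i
    using np by (simp add: sum_Pinfty)
  have "(\<Sum>j<n. inverse_barrier \<beta> (y i j)) = -\<infinity>"
    using ij np by (subst sum.remove[of "{..<n}" j]) (auto simp: sum_Pinfty inverse_barrier_def plus_ereal.simps)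
  then have "F y = -\<infinity>"
    unfolding separable_regularizer_def
    using ij np2 by (subst sum.remove[of "{..<n}" i]) (auto simp: sum_Pinfty plus_ereal.simps)
  then show ?thesis by (simp add: objective_def)
qed

text \<open>Strong midpoint convexity of the barrier: the convexity defect of \<open>1 / z\<close>
  is exactly \<open>(a - b)^2 / (2 * a * b * (a + b))\<close>, and the denominator is at most
  \<open>4\<close> on the unit interval.\<close>

lemma barrier_midpoint:
  assumes "0 < a" "a \<le> 1" "0 < b" "b \<le> (1::real)"
  shows "\<beta> / ((a + b) / 2) + \<beta> / 4 * (a - b)\<^sup>2 \<le> (\<beta> / a + \<beta> / b) / 2"
proof -
  have X: "2 * a * b * (a + b) \<le> 4"
  proof -
    have "a * b \<le> 1" using assms by (simp add: mult_le_one)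
    then have "a * b * (a + b) \<le> 1 * 2"
      using assms by (intro mult_mono) auto
    then show ?thesis by simp
  qed
  have "(a - b)\<^sup>2 / 4 \<le> (a - b)\<^sup>2 / (2 * a * b * (a + b))"
    using assms X by (intro divide_left_mono mult_pos_pos) auto
  also have "\<dots> = (1 / a + 1 / b) / 2 - 2 / (a + b)"
    using assms by (simp add: field_simps power2_eq_square)
  finally have "\<beta> * ((a - b)\<^sup>2 / 4) \<le> \<beta> * ((1 / a + 1 / b) / 2 - 2 / (a + b))"
    using \<beta>_pos by (intro mult_left_mono) auto
  moreover have "\<beta> / ((a + b) / 2) = \<beta> * 2 / (a + b)"
    by (simp only: divide_divide_eq_right)
  ultimately show ?thesis by (simp only:) (simp add: algebra_simps add_divide_distrib)
qed

definition dist2 :: "(nat \<Rightarrow> nat \<Rightarrow> real) \<Rightarrow> (nat \<Rightarrow> nat \<Rightarrow> real) \<Rightarrow> real" where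
  "dist2 y z = (\<Sum>i<n. \<Sum>j<n. (y i j - z i j)\<^sup>2)"

text \<open>The welfare is linear, so the convexity defect of the cost passes to the gain. The
  midpoint is written with \<open>1 - 1/2\<close> to be an instance of
  \<open>bistochastic_mix\<close>.\<close>

lemma gain_midpoint:
  assumes y: "y \<in> pos_bistochastic" and z: "z \<in> pos_bistochastic"
  defines "w \<equiv> \<lambda>i j. (1 - 1/2) * y i j + 1/2 * z i j"
  shows "w \<in> pos_bistochastic" "(gain l y + gain l z) / 2 + \<beta> / 4 * dist2 y z \<le> gain l w"
proof -
  note yb = pos_bistochasticD(1)[OF y] and zb = pos_bistochasticD(1)[OF z]
  have "w \<in> bistochastic n"
    unfolding w_def by (intro bistochastic_mix yb zb) auto
  then show "w \<in> pos_bistochastic"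
    using pos_bistochasticD(2)[OF y] pos_bistochasticD(2)[OF z]
    by (auto simp: pos_bistochastic_def w_def add_pos_pos)
  have w_eq: "w i j = (y i j + z i j) / 2" for i j by (simp add: w_def)
  have "cost w + \<beta> / 4 * dist2 y z =
      (\<Sum>i<n. \<Sum>j<n. \<beta> / ((y i j + z i j) / 2) + \<beta> / 4 * (y i j - z i j)\<^sup>2)"
    unfolding cost_def dist2_def w_eq sum_distrib_left sum.distrib by simp
  also have "\<dots> \<le> (\<Sum>i<n. \<Sum>j<n. (\<beta> / y i j + \<beta> / z i j) / 2)"
    using pos_bistochasticD(2)[OF y] pos_bistochasticD(2)[OF z] bistochasticD(2)[OF yb] bistochasticD(2)[OF zb]
    by (intro sum_mono barrier_midpoint) auto
  also have "\<dots> = (cost y + cost z) / 2"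
    by (simp add: cost_def sum.distrib flip: sum_divide_distrib)
  finally have "cost w + \<beta> / 4 * dist2 y z \<le> (cost y + cost z) / 2" .
  moreover have "score k w = (score k y + score k z) / 2" for k
    by (simp add: score_def w_eq algebra_simps sum.distrib flip: sum_divide_distrib)
  then have "welfare l w = (welfare l y + welfare l z) / 2"
    by (simp add: welfare_def sum_divide_distrib distrib_left add_divide_distrib flip: sum.distrib)
  ultimately show "(gain l y + gain l z) / 2 + \<beta> / 4 * dist2 y z \<le> gain l w"
    by (simp add: gain_def field_simps)
qed

section \<open>Existence and uniqueness of the regularized optimum\<close>

text \<open>Tychonoff's theorem is applied twice, once for each index.\<close>

lemma compact_matrices: "compact {y :: nat \<Rightarrow> nat \<Rightarrow> real. \<forall>k j. y k j \<in> {0..1}}"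
proof -
  have *: "compact {y :: 'a \<Rightarrow> 'b::topological_space. \<forall>k. y k \<in> S}" if "compact S" for S
  proof -
    have "compactin (product_topology (\<lambda>_::'a. euclidean) UNIV) (PiE UNIV (\<lambda>_. S))"
      unfolding compactin_PiE using that by simp
    then show ?thesis
      by (simp add: euclidean_product_topology PiE_UNIV_domain Pi_def)
  qed
  have "compact {y :: nat \<Rightarrow> nat \<Rightarrow> real. \<forall>k. y k \<in> {z. \<forall>j. z j \<in> {0..1}}}"
    by (intro * compact_Icc)
  then show ?thesis by simp
qed

lemma continuous_entry [continuous_intros]:
  "continuous_on S (\<lambda>y :: nat \<Rightarrow> nat \<Rightarrow> real. y i j)"
proof -
  have "continuous_on UNIV (\<lambda>y :: nat \<Rightarrow> nat \<Rightarrow> real. y i j)"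
    by (rule continuous_on_product_then_coordinatewise[OF continuous_on_product_coordinates])
  then show ?thesis by (rule continuous_on_subset) simp
qed

text \<open>For positive \<open>m\<close> the cost is continuous on this set, so a maximum of the
  gain can be found here.\<close>

lemma compact_bistochastic_ge:
  "compact {y \<in> bistochastic n. \<forall>i<n. \<forall>j<n. m \<le> y i j}"
proof -
  let ?K = "{y :: nat \<Rightarrow> nat \<Rightarrow> real. \<forall>k j. y k j \<in> {0..1}}"
  let ?C = "{y :: nat \<Rightarrow> nat \<Rightarrow> real.
     (\<forall>k. k < n \<longrightarrow> (\<Sum>j<n. y k j) = 1) \<and> (\<forall>j. j < n \<longrightarrow> (\<Sum>k<n. y k j) = 1) \<and>
     (\<forall>k j. \<not> (k < n \<and> j < n) \<longrightarrow> y k j = 0) \<and> (\<forall>i j. i < n \<longrightarrow> j < n \<longrightarrow> m \<le> y i j)}"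
  have "closed ?C"
    by (intro closed_Collect_conj closed_Collect_all closed_Collect_imp closed_Collect_eq
        closed_Collect_le open_Collect_const continuous_intros)
  then have "compact (?K \<inter> ?C)" by (rule compact_Int_closed[OF compact_matrices])
  moreover have "?K \<inter> ?C = {y \<in> bistochastic n. \<forall>i<n. \<forall>j<n. m \<le> y i j}"
    unfolding bistochastic_def by (auto, metis order_refl zero_le_one, metis zero_le_one order_refl)
  ultimately show ?thesis by simp
qed

text \<open>Below this value a single entry costs more than the whole uniform matrix, which costs
  \<open>\<beta> * n^3\<close>, plus a welfare advantage \<open>B\<close>.\<close>

definition floor_entry :: "real \<Rightarrow> real" where
  "floor_entry B = \<beta> / (\<beta> * real n ^ 3 + B)"

lemma floor_entry_pos: "0 \<le> B \<Longrightarrow> 0 < floor_entry B"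
  unfolding floor_entry_def using \<beta>_pos n_pos by (intro divide_pos_pos add_pos_nonneg) auto

lemma cost_uniform: "cost uniform = \<beta> * real n ^ 3"
proof -
  have "cost uniform = (\<Sum>i<n. \<Sum>j<n. \<beta> * real n)"
    unfolding cost_def by (intro sum.cong) (auto simp: uniform_def)
  then show ?thesis by (simp add: power3_eq_cube)
qed

lemma entries_ge_floor:
  assumes y: "y \<in> pos_bistochastic" and g: "gain l uniform \<le> gain l y"
    and B: "welfare l y - welfare l uniform \<le> B" "0 \<le> B" and ij: "i < n" "j < n"
  shows "floor_entry B \<le> y i j"
proof -
  have "\<beta> / y i j \<le> cost y" using cost_ge_entry pos_bistochasticD(1)[OF y] ij by blast
  also have "\<dots> \<le> \<beta> * real n ^ 3 + B" using g B by (simp add: gain_def cost_uniform)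
  finally have "\<beta> / y i j \<le> \<beta> * real n ^ 3 + B" .
  moreover have "0 < \<beta> * real n ^ 3 + B" using \<beta>_pos n_pos B by (intro add_pos_nonneg) auto
  ultimately show ?thesis
    using pos_bistochasticD(2)[OF y ij] by (simp add: floor_entry_def field_simps)
qed

text \<open>Every matrix at least as good as \<open>uniform\<close> has entries bounded below by
  \<open>floor_entry\<close>, so the search reduces to a compact set.\<close>

lemma gain_maximizer_exists:
  "\<exists>y \<in> pos_bistochastic. \<forall>z \<in> pos_bistochastic. gain l z \<le> gain l y"
proof -
  define B where "B = 2 * (\<Sum>k<n. \<bar>l k\<bar>)"
  have B0: "0 \<le> B" unfolding B_def by (simp add: sum_nonneg)
  have Bb: "welfare l y - welfare l uniform \<le> B" if "y \<in> pos_bistochastic" for y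
  proof -
    have "\<bar>welfare l z\<bar> \<le> (\<Sum>k<n. \<bar>l k\<bar>)" if "z \<in> bistochastic n" for z
      using gain_diff_le[OF that, of l "\<lambda>_. 0"] by (simp add: gain_def welfare_def)
    from this[of y] this[of uniform] show ?thesis
      using that pos_bistochasticD(1) uniform_bistochastic unfolding B_def by fastforce
  qed
  \<comment> \<open>The second term of the minimum keeps \<open>uniform\<close> itself in the
    compact set.\<close>
  define m where "m = min (floor_entry B) (1 / real n)"
  have m: "0 < m" using floor_entry_pos[OF B0] n_pos by (simp add: m_def)
  let ?K = "{y \<in> bistochastic n. \<forall>i<n. \<forall>j<n. m \<le> y i j}"
  have KX: "?K \<subseteq> pos_bistochastic"
    using m unfolding pos_bistochastic_def by fastforce
  have uK: "uniform \<in> ?K"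
    using pos_bistochasticD(1)[OF uniform_bistochastic] by (auto simp: uniform_def m_def)
  have "continuous_on ?K (gain l)"
    unfolding gain_def welfare_def cost_def score_def
    by (intro continuous_intros) (use m in fastforce)
  moreover have "?K \<noteq> {}" using uK by blast
  ultimately have "\<exists>y\<in>?K. \<forall>z\<in>?K. gain l z \<le> gain l y"
    by (intro continuous_attains_sup[OF compact_bistochastic_ge])
  then obtain y where y: "y \<in> ?K" and Y: "\<forall>z\<in>?K. gain l z \<le> gain l y" by (rule bexE)
  have y_max: "gain l z \<le> gain l y" if "z \<in> ?K" for z using Y that by (rule bspec)
  have "gain l z \<le> gain l y" if "z \<in> pos_bistochastic" for z
  proof (cases "gain l uniform \<le> gain l z")
    case True
    then have "z \<in> ?K"
      using entries_ge_floor[OF that True Bb[OF that] B0] pos_bistochasticD(1)[OF that]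
      by (auto simp: m_def min_le_iff_disj)
    then show ?thesis by (rule y_max)
  next
    case False
    then show ?thesis using y_max[OF uK] by linarith
  qed
  then show ?thesis using subsetD[OF KX y] by blast
qed

text \<open>Comparing a maximizer with the midpoint between it and \<open>y\<close> doubles the
  constant \<open>\<beta> / 4\<close> of \<open>gain_midpoint\<close>. The resulting strong
  optimality gives uniqueness, which makes the definite description in \<open>allocation\<close>
  meaningful.\<close>

lemma allocation_properties:
  shows allocation_pos: "x l \<in> pos_bistochastic"
    and allocation_strongly_optimal:
      "\<And>y. y \<in> pos_bistochastic \<Longrightarrow> gain l y + \<beta> / 2 * dist2 (x l) y \<le> gain l (x l)"
    and opt0_eq: "\<Phi> l = gain l (x l)"
proof -
  obtain y where y: "y \<in> pos_bistochastic" "\<And>z. z \<in> pos_bistochastic \<Longrightarrow> gain l z \<le> gain l y"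
    using gain_maximizer_exists by blast
  have strong: "gain l z + \<beta> / 2 * dist2 y z \<le> gain l y" if "z \<in> pos_bistochastic" for z
    using gain_midpoint(2)[OF y(1) that, of l] y(2)[OF gain_midpoint(1)[OF y(1) that]] by argo
  have unique: "z = y" if z: "z \<in> pos_bistochastic" "gain l y \<le> gain l z" for z
  proof -
    have "\<beta> / 2 * dist2 y z \<le> 0" using strong[OF z(1)] z(2) by linarith
    then have "dist2 y z \<le> 0" using \<beta>_pos by (simp add: mult_le_0_iff)
    then have d0: "dist2 y z = 0" by (simp add: antisym dist2_def sum_nonneg)
    have "y i j = z i j" if "i < n" "j < n" for i j
      using d0 that by (simp add: dist2_def sum_nonneg_eq_0_iff sum_nonneg)
    moreover have "y i j = z i j" if "\<not> (i < n \<and> j < n)" for i j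
      using bistochasticD(5)[OF pos_bistochasticD(1)[OF y(1)] that]
        bistochasticD(5)[OF pos_bistochasticD(1)[OF z(1)] that] by simp
    ultimately show ?thesis by (intro ext) metis
  qed
  have le: "objective n F u l z \<le> ereal (gain l y)" if "z \<in> bistochastic n" for z
    using that y(2) objective_pos objective_not_pos by (cases "z \<in> pos_bistochastic") auto
  have obj_y: "objective n F u l y = ereal (gain l y)" by (rule objective_pos[OF y(1)])
  have xy: "x l = y"
    unfolding allocation_def
  proof (rule the_equality)
    show "is_arg_max (objective n F u l) (\<lambda>x. x \<in> bistochastic n) y"
      using le pos_bistochasticD(1)[OF y(1)] obj_y by (auto simp: is_arg_max_def not_less)
  next
    fix z assume z: "is_arg_max (objective n F u l) (\<lambda>x. x \<in> bistochastic n) z"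
    then have zb: "z \<in> bistochastic n" and ge: "ereal (gain l y) \<le> objective n F u l z"
      using pos_bistochasticD(1)[OF y(1)] obj_y by (auto simp: is_arg_max_def not_less)
    then have "z \<in> pos_bistochastic" using objective_not_pos[of z l] by fastforce
    with ge show "z = y" by (intro unique) (auto simp: objective_pos)
  qed
  show "x l \<in> pos_bistochastic" using xy y by simp
  show "gain l z + \<beta> / 2 * dist2 (x l) z \<le> gain l (x l)" if "z \<in> pos_bistochastic" for z
    using strong[OF that] xy by simp
  have "(SUP z\<in>bistochastic n. objective n F u l z) = ereal (gain l y)"
    using le obj_y pos_bistochasticD(1)[OF y(1)]
    by (intro antisym SUP_least) (auto intro: SUP_upper2)
  then show "\<Phi> l = gain l (x l)" by (simp add: opt0_def xy)
qed

lemma allocation_bistochastic: "x l \<in> bistochastic n"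
  using allocation_pos pos_bistochasticD(1) by blast

lemma dist2_nonneg: "0 \<le> dist2 y z"
  by (simp add: dist2_def sum_nonneg)

lemma gain_le_opt0:
  assumes "y \<in> pos_bistochastic"
  shows "gain l y \<le> \<Phi> l"
proof -
  have "0 \<le> \<beta> / 2 * dist2 (x l) y" using \<beta>_pos dist2_nonneg by simp
  then show ?thesis using allocation_strongly_optimal[OF assms, of l] by (simp add: opt0_eq)
qed

lemma utility_eq: "U i l = score i (x l)"
  by (simp add: utility_def score_def)

lemma utility_range: "i < n \<Longrightarrow> 0 \<le> U i l" "i < n \<Longrightarrow> U i l \<le> 1"
  by (simp_all add: utility_eq score_range[OF allocation_bistochastic])

lemma payment_eq: "P i l = \<Phi> (l(i := 0)) - \<Phi> l + l i * U i l"
  by (simp add: payment_def utility_def sum_distrib_left mult.assoc)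

lemma opt0_diff_le: "\<bar>\<Phi> l' - \<Phi> l\<bar> \<le> (\<Sum>k<n. \<bar>l' k - l k\<bar>)"
proof -
  have *: "\<Phi> l' - \<Phi> l \<le> (\<Sum>k<n. \<bar>l' k - l k\<bar>)" for l l'
    using gain_le_opt0[OF allocation_pos, of l l'] gain_diff_le[OF allocation_bistochastic, of l' l' l]
    by (simp add: opt0_eq)
  show ?thesis using *[of l' l] *[of l l'] by (simp add: abs_le_iff abs_minus_commute)
qed

section \<open>Dependence on a player's own bid\<close>

text \<open>
  The convex function \<open>\<Phi>\<close> has partial derivative \<open>U i\<close> in the bid of player \<open>i\<close>; \<open>gap\<close> is its
  Bregman divergence. A player with Lagrangian \<open>a * U - P\<close> loses \<open>gap i l a\<close> by bidding \<open>l i\<close>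
  instead of \<open>a\<close>.
\<close>

definition gap :: "nat \<Rightarrow> (nat \<Rightarrow> real) \<Rightarrow> real \<Rightarrow> real" where
  "gap i l a = \<Phi> (l(i := a)) - \<Phi> l - (a - l i) * U i l"

text \<open>The gain of the fixed matrix \<open>x l\<close> is affine in the bid with slope
  \<open>U i l\<close>. Hence the gap is the loss from keeping the old optimum under the new bid,
  and strong optimality applies to it.\<close>

lemma gap_eq:
  assumes "i < n"
  shows "gap i l a = \<Phi> (l(i := a)) - gain (l(i := a)) (x l)"
  by (simp add: gap_def gain_upd[OF assms] opt0_eq[of l] utility_eq)

lemma gap_ge_dist2:
  assumes "i < n"
  shows "\<beta> / 2 * dist2 (x (l(i := a))) (x l) \<le> gap i l a"
  using allocation_strongly_optimal[OF allocation_pos, of "l(i := a)" l]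
  by (simp add: gap_eq[OF assms] opt0_eq[of "l(i := a)"])

lemma gap_nonneg: "i < n \<Longrightarrow> 0 \<le> gap i l a"
  using gap_ge_dist2[of i l a] dist2_nonneg[of "x (l(i := a))" "x l"] \<beta>_pos
  by (meson divide_nonneg_nonneg less_imp_le mult_nonneg_nonneg order_trans zero_le_numeral)

lemma gap_lagrangian:
  "a * U i (l(i := a)) - P i (l(i := a)) - (a * U i l - P i l) = gap i l a"
  by (simp add: gap_def payment_eq algebra_simps)

text \<open>In the symmetrized Bregman divergence the values of \<open>\<Phi>\<close> cancel. Its
  sign gives monotonicity of the utility, its quadratic lower bound gives Lipschitz
  continuity.\<close>

lemma gap_symmetric:
  "gap i l a + gap i (l(i := a)) (l i) = (a - l i) * (U i (l(i := a)) - U i l)"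
  by (simp add: gap_def algebra_simps)

lemma utility_mono:
  assumes "i < n" "l i \<le> a"
  shows "U i l \<le> U i (l(i := a))"
proof (cases "l i = a")
  case False
  have "0 \<le> (a - l i) * (U i (l(i := a)) - U i l)"
    using gap_nonneg[OF assms(1)] gap_symmetric[of i l a] by (metis add_nonneg_nonneg)
  then show ?thesis using False assms by (simp add: zero_le_mult_iff)
qed (metis fun_upd_triv order_refl)

text \<open>A player with Lagrangian \<open>l i * U - P\<close> prefers the bid \<open>l i\<close>
  to \<open>a\<close>. Since \<open>a\<close> gives her at least as much utility, it must also cost
  at least as much.\<close>

lemma payment_mono:
  assumes "i < n" "0 \<le> l i" "l i \<le> a"
  shows "P i l \<le> P i (l(i := a))"
proof -
  have "0 \<le> l i * (U i (l(i := a)) - U i l)"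
    using utility_mono assms by simp
  then show ?thesis
    using gap_nonneg[OF assms(1), of "l(i := a)" "l i"] gap_lagrangian[of "l i" i "l(i := a)"]
    by (simp add: algebra_simps)
qed

lemma payment_zero: "P i (l(i := 0)) = 0"
  by (simp add: payment_eq)

text \<open>With \<open>D\<close> the squared distance of the two allocations and \<open>w\<close>
  the utility change, strong optimality gives
  \<open>\<beta> * D \<le> \<bar>a - l i\<bar> * \<bar>w\<bar>\<close>, and Cauchy-Schwarz gives
  \<open>w^2 \<le> n * D\<close>. One factor \<open>\<bar>w\<bar>\<close> cancels.\<close>

lemma utility_lipschitz:
  assumes i: "i < n"
  shows "\<bar>U i (l(i := a)) - U i l\<bar> \<le> real n / \<beta> * \<bar>a - l i\<bar>"
proof -
  define D where "D = dist2 (x (l(i := a))) (x l)"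
  define w where "w = U i (l(i := a)) - U i l"
  have sym: "dist2 y z = dist2 z y" for y z
    by (simp add: dist2_def power2_commute)
  have "\<beta> / 2 * D \<le> gap i l a" "\<beta> / 2 * D \<le> gap i (l(i := a)) (l i)"
    using gap_ge_dist2[OF i, of l a] gap_ge_dist2[OF i, of "l(i := a)" "l i"]
    by (simp_all add: D_def sym)
  then have "\<beta> * D \<le> (a - l i) * w"
    using gap_symmetric[of i l a] by (simp add: w_def)
  also have "\<dots> \<le> \<bar>a - l i\<bar> * \<bar>w\<bar>"
    by (metis abs_ge_self abs_mult)
  finally have 1: "\<beta> * D \<le> \<bar>a - l i\<bar> * \<bar>w\<bar>" .
  let ?d = "\<lambda>j. x (l(i := a)) i j - x l i j"
  have "w\<^sup>2 = (\<Sum>j<n. u i j * ?d j)\<^sup>2"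
    by (simp add: w_def utility_eq score_def algebra_simps sum_subtractf)
  also have "\<dots> \<le> (\<Sum>j<n. (u i j * ?d j)\<^sup>2) * real n"
    using sum_squared_le_sum_of_squares[of "\<lambda>j. u i j * ?d j" "{..<n}"] by simp
  also have "\<dots> \<le> (\<Sum>j<n. (?d j)\<^sup>2) * real n"
  proof (intro mult_right_mono sum_mono)
    fix j assume "j \<in> {..<n}"
    then have "(u i j)\<^sup>2 \<le> 1" using u_range[OF i, of j] by (simp add: power_le_one)
    then show "(u i j * ?d j)\<^sup>2 \<le> (?d j)\<^sup>2"
      by (simp add: power_mult_distrib mult_left_le_one_le)
  qed simp
  also have "\<dots> \<le> D * real n"
    unfolding D_def dist2_def using i
    by (intro mult_right_mono member_le_sum[of i "{..<n}"] sum_nonneg) auto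
  finally have "\<beta> * w\<^sup>2 \<le> \<beta> * (D * real n)"
    using \<beta>_pos by (intro mult_left_mono) auto
  also have "\<dots> \<le> \<bar>a - l i\<bar> * \<bar>w\<bar> * real n"
    using mult_right_mono[OF 1, of "real n"] by (simp add: mult.assoc)
  finally have "\<bar>w\<bar> * (\<beta> * \<bar>w\<bar>) \<le> \<bar>w\<bar> * (real n * \<bar>a - l i\<bar>)"
    using abs_mult_self_eq[of w] by (simp add: power2_eq_square mult_ac)
  then have "\<beta> * \<bar>w\<bar> \<le> real n * \<bar>a - l i\<bar>"
    by (cases "w = 0") auto
  then show ?thesis using \<beta>_pos by (simp add: w_def field_simps)
qed

lemma continuous_utility: "i < n \<Longrightarrow> continuous_on S (\<lambda>a. U i (l(i := a)))"
proof (rule lipschitz_on_continuous_on[OF lipschitz_onI])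
  fix a a' :: real assume "i < n"
  then show "dist (U i (l(i := a))) (U i (l(i := a'))) \<le> real n / \<beta> * dist a a'"
    using utility_lipschitz[of i "l(i := a')" a] by (simp add: dist_real_def)
qed (use \<beta>_pos in simp)

lemma continuous_payment:
  assumes "i < n"
  shows "continuous_on S (\<lambda>a. P i (l(i := a)))"
proof -
  have "continuous_on S (\<lambda>a. \<Phi> (l(i := a)))"
  proof (rule lipschitz_on_continuous_on[OF lipschitz_onI])
    fix a a' :: real
    have "\<bar>\<Phi> (l(i := a)) - \<Phi> (l(i := a'))\<bar> \<le> (\<Sum>k<n. if k = i then \<bar>a - a'\<bar> else 0)"
      by (rule order_trans[OF opt0_diff_le], rule sum_mono) simp
    then show "dist (\<Phi> (l(i := a))) (\<Phi> (l(i := a'))) \<le> 1 * dist a a'"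
      using assms by (simp add: dist_real_def)
  qed simp
  then have "continuous_on S (\<lambda>a. \<Phi> (l(i := 0)) - \<Phi> (l(i := a)) + a * U i (l(i := a)))"
    by (intro continuous_intros continuous_utility assms)
  then show ?thesis by (simp add: payment_eq)
qed

section \<open>Quadratic lower bounds for the gap\<close>

text \<open>Taylor expansion with the exact remainder
  \<open>\<beta> * e^2 / (z^2 * (z + e))\<close>; the assumptions give
  \<open>z + e \<ge> m / 2\<close>.\<close>

lemma barrier_perturb:
  assumes "0 < m" "m \<le> z" "\<bar>e\<bar> \<le> m / 2"
  shows "\<beta> / (z + e) \<le> \<beta> / z - \<beta> * e / z\<^sup>2 + e\<^sup>2 * (2 * \<beta> / m ^ 3)"
proof -
  have z: "0 < z" "m / 2 \<le> z + e" "0 < z + e" using assms by (auto simp: abs_le_iff)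
  have "m\<^sup>2 * (m / 2) \<le> z\<^sup>2 * (z + e)"
    using assms z by (intro mult_mono power_mono) auto
  then have "1 / (z\<^sup>2 * (z + e)) \<le> 1 / (m\<^sup>2 * (m / 2))"
    using assms z by (intro divide_left_mono mult_pos_pos) auto
  then have "\<beta> * e\<^sup>2 * (1 / (z\<^sup>2 * (z + e))) \<le> \<beta> * e\<^sup>2 * (1 / (m\<^sup>2 * (m / 2)))"
    using \<beta>_pos by (intro mult_left_mono) auto
  also have "\<dots> = e\<^sup>2 * (2 * \<beta> / m ^ 3)"
    by (simp add: power2_eq_square power3_eq_cube)
  finally have "\<beta> * e\<^sup>2 * (1 / (z\<^sup>2 * (z + e))) \<le> e\<^sup>2 * (2 * \<beta> / m ^ 3)" .
  moreover have "\<beta> / q = \<beta> / z - \<beta> * (q - z) / z\<^sup>2 + \<beta> * (q - z)\<^sup>2 * (1 / (z\<^sup>2 * q))" if "0 < q" for q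
    using z that by (simp add: field_simps power2_eq_square)
  from this[OF z(3)] have "\<beta> / (z + e) = \<beta> / z - \<beta> * e / z\<^sup>2 + \<beta> * e\<^sup>2 * (1 / (z\<^sup>2 * (z + e)))"
    by simp
  ultimately show ?thesis by simp
qed

text \<open>Tangent directions of the bistochastic matrices, scaled so that a step of length at most
  \<open>m / 2\<close> changes no entry by more than \<open>m / 2\<close>.\<close>

definition direction :: "(nat \<Rightarrow> nat \<Rightarrow> real) \<Rightarrow> bool" where
  "direction d \<longleftrightarrow> (\<forall>i j. \<bar>d i j\<bar> \<le> 1) \<and> (\<forall>i<n. (\<Sum>j<n. d i j) = 0) \<and>
     (\<forall>j<n. (\<Sum>i<n. d i j) = 0) \<and> (\<forall>i j. \<not> (i < n \<and> j < n) \<longrightarrow> d i j = 0)"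

lemma perturb:
  assumes y: "y \<in> bistochastic n" and m: "0 < m" "\<forall>i<n. \<forall>j<n. m \<le> y i j"
    and d: "direction d" and s: "\<bar>s\<bar> \<le> m / 2"
  defines "z \<equiv> \<lambda>i j. y i j + s * d i j"
  shows "z \<in> pos_bistochastic"
    and "score i z = score i y + s * score i d"
    and "cost z \<le> cost y - s * (\<Sum>i<n. \<Sum>j<n. \<beta> * d i j / (y i j)\<^sup>2) + s\<^sup>2 * (2 * real n ^ 2 * \<beta> / m ^ 3)"
proof -
  have sd: "\<bar>s * d i j\<bar> \<le> m / 2" for i j
    using d s mult_mono[of "\<bar>s\<bar>" "m/2" "\<bar>d i j\<bar>" 1] m by (auto simp: direction_def abs_mult)
  have pos: "0 < z i j" if "i < n" "j < n" for i j
    using m(2)[rule_format, OF that] sd[of i j] m(1) by (auto simp: z_def abs_le_iff)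
  have "z \<in> bistochastic n"
    using pos d bistochasticD(3-5)[OF y]
    by (intro bistochasticI)
      (auto simp: z_def direction_def sum.distrib less_imp_le simp flip: sum_distrib_left)
  then show "z \<in> pos_bistochastic" using pos by (simp add: pos_bistochastic_def)
  show "score i z = score i y + s * score i d"
    by (simp add: score_def z_def algebra_simps sum.distrib sum_distrib_left)
  have "cost z \<le> (\<Sum>i<n. \<Sum>j<n. \<beta> / y i j - s * (\<beta> * d i j / (y i j)\<^sup>2) + s\<^sup>2 * (2 * \<beta> / m ^ 3))"
    unfolding cost_def
  proof (intro sum_mono)
    fix i j assume "i \<in> {..<n}" "j \<in> {..<n}"
    then have "\<beta> / z i j \<le> \<beta> / y i j - \<beta> * (s * d i j) / (y i j)\<^sup>2 + (s * d i j)\<^sup>2 * (2 * \<beta> / m ^ 3)"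
      unfolding z_def using m sd by (intro barrier_perturb) auto
    moreover have "(s * d i j)\<^sup>2 * (2 * \<beta> / m ^ 3) \<le> s\<^sup>2 * (2 * \<beta> / m ^ 3)"
    proof (rule mult_right_mono)
      have "\<bar>d i j\<bar> \<le> 1" using d by (simp add: direction_def)
      then have "(d i j)\<^sup>2 \<le> 1" by (simp add: abs_square_le_1)
      then show "(s * d i j)\<^sup>2 \<le> s\<^sup>2" by (simp add: power_mult_distrib mult_left_le)
    qed (use m \<beta>_pos in simp)
    ultimately show "\<beta> / z i j \<le> \<beta> / y i j - s * (\<beta> * d i j / (y i j)\<^sup>2) + s\<^sup>2 * (2 * \<beta> / m ^ 3)"
      by (simp add: mult_ac)
  qed
  also have "\<dots> = cost y - s * (\<Sum>i<n. \<Sum>j<n. \<beta> * d i j / (y i j)\<^sup>2) + s\<^sup>2 * (2 * real n ^ 2 * \<beta> / m ^ 3)"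
    by (simp add: cost_def sum.distrib sum_subtractf sum_distrib_left power2_eq_square)
  finally show "cost z \<le> cost y - s * (\<Sum>i<n. \<Sum>j<n. \<beta> * d i j / (y i j)\<^sup>2) + s\<^sup>2 * (2 * real n ^ 2 * \<beta> / m ^ 3)" .
qed

text \<open>First-order optimality condition without derivatives: a small step in the direction of
  the sign of \<open>A\<close> would otherwise win linearly and lose only quadratically.\<close>

lemma zero_if_quadratic_bound:
  fixes A K r :: real
  assumes "0 < r" "\<And>s. \<bar>s\<bar> \<le> r \<Longrightarrow> s * A \<le> s\<^sup>2 * K"
  shows "A = 0"
proof (rule ccontr)
  assume A: "A \<noteq> 0"
  define t where "t = min r (\<bar>A\<bar> / 2 / (\<bar>K\<bar> + 1))"
  have t: "0 < t" "t \<le> r" using A assms(1) by (auto simp: t_def)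
  have "t \<le> \<bar>A\<bar> / 2 / (\<bar>K\<bar> + 1)" by (simp add: t_def)
  then have tK: "t * (\<bar>K\<bar> + 1) \<le> \<bar>A\<bar> / 2" by (subst (asm) pos_le_divide_eq) auto
  have "(sgn A * t) * A \<le> (sgn A * t)\<^sup>2 * K"
    using t by (intro assms(2)) (simp add: abs_mult abs_sgn_eq A)
  then have "t * \<bar>A\<bar> \<le> t\<^sup>2 * K"
    using A by (simp add: power_mult_distrib sgn_if split: if_splits)
  then have "\<bar>A\<bar> \<le> t * K" using t by (simp add: power2_eq_square)
  also have "\<dots> \<le> t * (\<bar>K\<bar> + 1)" using t by (intro mult_left_mono) auto
  finally show False using tK A by simp
qed

text \<open>At the optimum for \<open>l\<close> the directional derivative \<open>A\<close> of the
  gain vanishes. Under the bid \<open>a\<close> only the linear term from the changed bid and the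
  second-order loss of the barrier remain.\<close>

lemma gap_ge_direction:
  assumes i: "i < n" and m: "0 < m" "\<forall>i<n. \<forall>j<n. m \<le> x l i j"
    and d: "direction d" and s: "\<bar>s\<bar> \<le> m / 2"
  shows "s * (a - l i) * score i d - s\<^sup>2 * (2 * real n ^ 2 * \<beta> / m ^ 3) \<le> gap i l a"
proof -
  define K where "K = 2 * real n ^ 2 * \<beta> / m ^ 3"
  define A where "A = welfare l d + (\<Sum>i<n. \<Sum>j<n. \<beta> * d i j / (x l i j)\<^sup>2)"
  define z where "z s = (\<lambda>i j. x l i j + s * d i j)" for s
  note pert = perturb[OF allocation_bistochastic m d, folded z_def K_def]
  have gain_z: "s * A - s\<^sup>2 * K \<le> gain l (z s) - gain l (x l)" if "\<bar>s\<bar> \<le> m / 2" for s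
  proof -
    have "welfare l (z s) = welfare l (x l) + s * welfare l d"
      by (simp add: welfare_def pert(2)[OF that] algebra_simps sum.distrib sum_distrib_left)
    then show ?thesis
      using pert(3)[OF that] by (simp add: gain_def A_def algebra_simps)
  qed
  have "s * A \<le> s\<^sup>2 * K" if "\<bar>s\<bar> \<le> m / 2" for s
    using gain_z[OF that] gain_le_opt0[OF pert(1)[OF that], of l] by (simp add: opt0_eq)
  then have "A = 0" using m(1) by (intro zero_if_quadratic_bound[of "m / 2"]) auto
  moreover have "gain (l(i := a)) (z s) - gain (l(i := a)) (x l) =
      gain l (z s) - gain l (x l) + s * (a - l i) * score i d"
    by (simp add: gain_upd[OF i] pert(2)[OF s] algebra_simps)
  moreover have "gain (l(i := a)) (z s) - gain (l(i := a)) (x l) \<le> gap i l a"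
    using gain_le_opt0[OF pert(1)[OF s], of "l(i := a)"] by (simp add: gap_eq[OF i])
  ultimately show ?thesis using gain_z[OF s] by (simp add: K_def)
qed

text \<open>The direction is a swap: player \<open>i\<close> receives more of \<open>j1\<close> and
  less of \<open>j0\<close>, and another player the reverse. Her score then grows at rate
  \<open>1\<close>.\<close>

lemma gap_ge_square:
  assumes i: "i < n" and j: "j0 < n" "j1 < n" "u i j0 = 0" "u i j1 = 1"
    and m: "0 < m" "\<forall>i<n. \<forall>j<n. m \<le> x l i j"
    and K: "0 < K" "4 * real n ^ 2 * \<beta> / m ^ 3 \<le> K" "2 * \<bar>a - l i\<bar> / m \<le> K"
  shows "(a - l i)\<^sup>2 / (2 * K) \<le> gap i l a"
proof -
  have jne: "j0 \<noteq> j1" using j by auto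
  \<comment> \<open>Two distinct items force \<open>n \<ge> 2\<close>, so one of the players
    \<open>0\<close> and \<open>1\<close> differs from \<open>i\<close>.\<close>
  define k :: nat where "k = (if i = 0 then 1 else 0)"
  have k: "k < n" "k \<noteq> i" using i j jne by (auto simp: k_def)
  define r where "r = (\<lambda>k'. (if k' = i then 1 else 0) - (if k' = k then 1 else 0 :: real))"
  define c where "c = (\<lambda>j. (if j = j1 then 1 else 0) - (if j = j0 then 1 else 0 :: real))"
  define d where "d = (\<lambda>k' j. r k' * c j)"
  have sums: "(\<Sum>k'<n. r k') = 0" "(\<Sum>j<n. c j) = 0"
    using i j k by (auto simp: r_def c_def sum_subtractf)
  have d: "direction d"
    unfolding direction_def
  proof (intro conjI allI impI)
    show "\<bar>d i' j'\<bar> \<le> 1" for i' j'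
      unfolding d_def abs_mult by (rule mult_le_one) (auto simp: r_def c_def)
    show "(\<Sum>j'<n. d i' j') = 0" "(\<Sum>i'<n. d i' j') = 0" for i' j'
      using sums by (simp_all add: d_def flip: sum_distrib_left sum_distrib_right)
    show "d i' j' = 0" if "\<not> (i' < n \<and> j' < n)" for i' j'
      using that i j k by (auto simp: d_def r_def c_def)
  qed
  have "score i d = (\<Sum>j<n. u i j * c j)"
    using k by (simp add: score_def d_def r_def)
  also have "\<dots> = (\<Sum>j<n. (if j = j1 then u i j else 0) - (if j = j0 then u i j else 0))"
    by (intro sum.cong) (auto simp: c_def)
  also have "\<dots> = 1" using j by (simp add: sum_subtractf)
  finally have sc: "score i d = 1" .
  \<comment> \<open>This step maximizes \<open>s * (a - l i) - s^2 * K / 2\<close>; the last bound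
    on \<open>K\<close> keeps it within \<open>m / 2\<close>.\<close>
  define s where "s = (a - l i) / K"
  have "\<bar>s\<bar> \<le> m / 2"
    using K m(1) by (simp add: s_def field_simps)
  from gap_ge_direction[OF i m d this, of a]
  have "s * (a - l i) - s\<^sup>2 * (2 * real n ^ 2 * \<beta> / m ^ 3) \<le> gap i l a"
    by (simp add: sc)
  moreover have "s\<^sup>2 * (2 * real n ^ 2 * \<beta> / m ^ 3) \<le> s\<^sup>2 * (K / 2)"
    using K(2) by (intro mult_left_mono) auto
  moreover have "s * (a - l i) - s\<^sup>2 * (K / 2) = (a - l i)\<^sup>2 / (2 * K)"
    using K(1) by (simp add: s_def field_simps power2_eq_square)
  ultimately show ?thesis by linarith
qed

text \<open>Without a uniform bound on the entries, the least entry still serves as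
  \<open>m\<close>. Strict positivity is what makes the best response unique.\<close>

lemma gap_pos:
  assumes i: "i < n" and j: "j0 < n" "j1 < n" "u i j0 = 0" "u i j1 = 1" and a: "a \<noteq> l i"
  shows "0 < gap i l a"
proof -
  define m where "m = Min ((\<lambda>(i, j). x l i j) ` ({..<n} \<times> {..<n}))"
  have fin: "finite ((\<lambda>(i, j). x l i j) ` ({..<n} \<times> {..<n}))" by simp
  have "m \<in> (\<lambda>(i, j). x l i j) ` ({..<n} \<times> {..<n})"
    unfolding m_def using n_pos by (intro Min_in) auto
  then have m: "0 < m" using pos_bistochasticD(2)[OF allocation_pos] by auto
  have mle: "\<forall>i<n. \<forall>j<n. m \<le> x l i j"
    unfolding m_def by (intro allI impI Min_le[OF fin]) auto
  define K where "K = 4 * real n ^ 2 * \<beta> / m ^ 3 + 2 * \<bar>a - l i\<bar> / m"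
  have K: "0 \<le> 4 * real n ^ 2 * \<beta> / m ^ 3" "0 < 2 * \<bar>a - l i\<bar> / m"
    using a m \<beta>_pos by auto
  have "(a - l i)\<^sup>2 / (2 * K) \<le> gap i l a"
    using K by (intro gap_ge_square[OF i j m mle]) (auto simp: K_def)
  moreover have "0 < (a - l i)\<^sup>2 / (2 * K)" using K a by (simp add: K_def)
  ultimately show ?thesis by linarith
qed

section \<open>Smoothed permutation matrices and payments at high bids\<close>

definition perm_matrix :: "(nat \<Rightarrow> nat) \<Rightarrow> nat \<Rightarrow> nat \<Rightarrow> real" where
  "perm_matrix p = (\<lambda>k j. if k < n \<and> j = p k then 1 else 0)"

lemma perm_matrix_bistochastic:
  assumes p: "p permutes {..<n}"
  shows "perm_matrix p \<in> bistochastic n"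
proof (rule bistochasticI)
  show "(\<Sum>j<n. perm_matrix p i j) = 1" if "i < n" for i
    using that permutes_in_image[OF p, of i] by (simp add: perm_matrix_def)
  show "(\<Sum>i<n. perm_matrix p i j) = 1" if "j < n" for j
  proof -
    have "(\<Sum>i<n. perm_matrix p i j) = (\<Sum>i<n. if i = inv p j then 1 else 0)"
      using permutes_inverses[OF p] by (intro sum.cong) (auto simp: perm_matrix_def)
    then show ?thesis using permutes_in_image[OF permutes_inv[OF p], of j] that by simp
  qed
qed (use permutes_in_image[OF p] in \<open>auto simp: perm_matrix_def\<close>)

text \<open>Mixing with the uniform matrix raises all entries to at least
  \<open>\<theta> / n\<close>, which makes the cost finite, and loses at most the fraction
  \<open>\<theta>\<close> of each assigned utility.\<close>

lemma perm_mix: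
  assumes p: "p permutes {..<n}" and \<theta>: "0 < \<theta>" "\<theta> \<le> 1"
  obtains z where "z \<in> pos_bistochastic" "cost z \<le> real n ^ 3 * \<beta> / \<theta>"
    "\<And>k. k < n \<Longrightarrow> (1 - \<theta>) * u k (p k) \<le> score k z"
proof -
  define z where "z = (\<lambda>i j. (1 - \<theta>) * perm_matrix p i j + \<theta> * uniform i j)"
  have entry: "\<theta> / real n \<le> z i j" if "i < n" "j < n" for i j
    using that \<theta> by (simp add: z_def uniform_def perm_matrix_def)
  have zb: "z \<in> bistochastic n"
    unfolding z_def using \<theta> uniform_bistochastic
    by (intro bistochastic_mix perm_matrix_bistochastic p) (auto simp: pos_bistochastic_def)
  have mp: "0 < \<theta> / real n" using \<theta> n_pos by simp
  have "cost z \<le> real n ^ 2 * \<beta> / (\<theta> / real n)"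
    by (intro cost_le mp entry)
  then have "cost z \<le> real n ^ 3 * \<beta> / \<theta>"
    by (simp add: power2_eq_square power3_eq_cube mult_ac)
  moreover have "(1 - \<theta>) * u k (p k) \<le> score k z" if "k < n" for k
  proof -
    have "score k z = (1 - \<theta>) * score k (perm_matrix p) + \<theta> * score k uniform"
      by (simp add: score_def z_def algebra_simps sum.distrib sum_distrib_left sum_subtractf)
    moreover have "score k (perm_matrix p) = (\<Sum>j<n. if j = p k then u k j else 0)"
      unfolding score_def using that by (intro sum.cong) (auto simp: perm_matrix_def)
    moreover have "0 \<le> score k uniform"
      using score_range uniform_bistochastic that by (auto simp: pos_bistochastic_def)
    ultimately show ?thesis
      using permutes_in_image[OF p, of k] that \<theta> by simp
  qed
  moreover have "z \<in> pos_bistochastic"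
    using zb mp entry by (auto simp: pos_bistochastic_def intro: less_le_trans)
  ultimately show ?thesis using that by blast
qed

lemma welfare_abs_le:
  assumes "y \<in> bistochastic n"
  shows "\<bar>welfare l y\<bar> \<le> (\<Sum>k<n. \<bar>l k\<bar>)"
  using gain_diff_le[OF assms, of l "\<lambda>_. 0"] by (simp add: gain_def welfare_def)

text \<open>
  A high bid forces the entry of an item of utility \<open>0\<close> to be small, at a high cost for the others.
\<close>

lemma payment_unbounded:
  assumes i: "i < n" and j: "j0 < n" "j1 < n" "u i j0 = 0" "u i j1 = 1"
  obtains a where "0 \<le> a" "M \<le> P i (l(i := a))"
proof -
  define h where "h = l(i := 0)"
  define B where "B = (\<Sum>k<n. \<bar>h k\<bar>)"
  have B: "0 \<le> B" unfolding B_def by (simp add: sum_nonneg)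
  \<comment> \<open>The payment is at least \<open>\<beta> / y i j0 - 2 * B - \<beta> * n^3\<close>,
    so it reaches \<open>M\<close> once \<open>\<beta> / y i j0 \<ge> M'\<close>.\<close>
  define M' where "M' = \<bar>M\<bar> + 2 * B + \<beta> * real n ^ 3"
  have M': "0 < M'" unfolding M'_def using B \<beta>_pos n_pos by (intro add_nonneg_pos) auto
  define \<theta> where "\<theta> = min 1 (\<beta> / (2 * M'))"
  have \<theta>: "0 < \<theta>" "\<theta> \<le> 1" using M' \<beta>_pos by (auto simp: \<theta>_def)
  \<comment> \<open>This makes the error \<open>2 * B + n^3 * \<beta> / \<theta>\<close> equal to
    \<open>a * \<theta>\<close>, so that
    \<open>y i j0 \<le> 2 * \<theta> \<le> \<beta> / M'\<close>.\<close>
  define a where "a = (2 * B + real n ^ 3 * \<beta> / \<theta>) / \<theta>"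
  have a: "0 < a" unfolding a_def using \<theta> B \<beta>_pos n_pos
    by (intro divide_pos_pos add_nonneg_pos) auto
  have la: "l(i := a) = h(i := a)" and hi: "h i = 0" by (simp_all add: h_def)
  define y where "y = x (l(i := a))"
  have y: "y \<in> pos_bistochastic" "y \<in> bistochastic n"
    unfolding y_def using allocation_pos allocation_bistochastic by auto
  have \<Phi>y: "\<Phi> (l(i := a)) = gain h y + a * score i y"
    using gain_upd[OF i, of h a y] by (simp add: opt0_eq la y_def hi)
  have "Transposition.transpose i j1 permutes {..<n}"
    using i j by (intro permutes_swap_id) auto
  then obtain z where z: "z \<in> pos_bistochastic" "cost z \<le> real n ^ 3 * \<beta> / \<theta>"
    "\<And>k. k < n \<Longrightarrow> (1 - \<theta>) * u k (Transposition.transpose i j1 k) \<le> score k z"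
    using perm_mix \<theta> by blast
  have "1 - \<theta> \<le> score i z" using z(3)[OF i] j by simp
  then have "a * (1 - \<theta>) \<le> a * score i z" using a by simp
  moreover have "- B \<le> welfare h z"
    using welfare_abs_le[of z h] z(1) by (auto simp: pos_bistochastic_def B_def)
  moreover have "gain h z + a * score i z \<le> \<Phi> (l(i := a))"
    using gain_le_opt0[OF z(1), of "l(i := a)"] gain_upd[OF i, of h a z] by (simp add: la hi)
  ultimately have lower: "a * (1 - \<theta>) - B - real n ^ 3 * \<beta> / \<theta> \<le> \<Phi> (l(i := a))"
    using z(2) by (simp add: gain_def)
  have "score i y = (\<Sum>j\<in>{..<n} - {j0}. u i j * y i j)"
    using j by (simp add: score_def sum.remove[of "{..<n}" j0])
  also have "\<dots> \<le> (\<Sum>j\<in>{..<n} - {j0}. y i j)"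
    using u_range[OF i] i y by (intro sum_mono mult_left_le_one_le) (auto simp: bistochasticD)
  also have "\<dots> = 1 - y i j0"
    using bistochasticD(3)[OF y(2) i] j by (simp add: sum.remove[of "{..<n}" j0])
  finally have "a * score i y \<le> a * (1 - y i j0)" using a by simp
  moreover have upper: "gain h y \<le> B - \<beta> / y i j0"
    using welfare_abs_le[OF y(2), of h] cost_ge_entry[OF y(2) i j(1)] by (simp add: gain_def B_def)
  moreover have ypos: "0 < \<beta> / y i j0" using \<beta>_pos pos_bistochasticD(2)[OF y(1) i j(1)] by simp
  ultimately have "a * (1 - \<theta>) - B - real n ^ 3 * \<beta> / \<theta> \<le> B + a * (1 - y i j0)"
    using lower \<Phi>y by linarith
  then have "a * y i j0 \<le> a * \<theta> + (2 * B + real n ^ 3 * \<beta> / \<theta>)"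
    by (simp add: algebra_simps)
  also have "\<dots> = a * (2 * \<theta>)" using \<theta> by (simp add: a_def)
  finally have "y i j0 \<le> 2 * \<theta>" using a by simp
  also have "\<dots> \<le> \<beta> / M'" by (simp add: \<theta>_def min_def)
  finally have "M' \<le> \<beta> / y i j0"
    using M' pos_bistochasticD(2)[OF y(1) i j(1)] by (simp add: field_simps)
  moreover have "- B - \<beta> * real n ^ 3 \<le> \<Phi> h"
    using gain_le_opt0[OF uniform_bistochastic, of h] welfare_abs_le[of uniform h] uniform_bistochastic
    by (simp add: gain_def cost_uniform pos_bistochastic_def B_def)
  moreover have "P i (l(i := a)) = \<Phi> h - gain h y"
    using \<Phi>y by (simp add: payment_eq utility_eq y_def h_def)
  ultimately have "M \<le> P i (l(i := a))"
    using upper by (simp add: M'_def)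
  then show ?thesis using a that[of a] by simp
qed

end

section \<open>Executions and best responses\<close>

locale market = regularized +
  fixes L :: real and T :: nat and b :: "nat \<Rightarrow> nat \<Rightarrow> real"
  assumes L_gt: "10 < L" and T_pos: "1 \<le> T"
    and has_zero: "\<And>i. i < n \<Longrightarrow> \<exists>j<n. u i j = 0"
    and has_one: "\<And>i. i < n \<Longrightarrow> \<exists>j<n. u i j = 1"
    and bids: "\<And>t k. t < T \<Longrightarrow> k < n \<Longrightarrow> b t k \<in> {0..L}"
    and budget: "\<And>i. i < n \<Longrightarrow> (\<Sum>t<T. P i (b t)) \<le> real T"
begin

lemma payment_nonneg: "i < n \<Longrightarrow> 0 \<le> a \<Longrightarrow> 0 \<le> P i (l(i := a))"
  using payment_mono[of i "l(i := 0)" a] payment_zero[of i l] by simp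

text \<open>Individual rationality: a player pays at most the reported value of her bundle, because
  her absence cannot raise the optimum.\<close>

lemma payment_le_bid: "i < n \<Longrightarrow> 0 \<le> l i \<Longrightarrow> P i l \<le> l i"
proof -
  assume i: "i < n" and l: "0 \<le> l i"
  have "0 \<le> l i * U i (l(i := 0))" using utility_range(1)[OF i] l by simp
  then have "\<Phi> (l(i := 0)) \<le> \<Phi> l"
    using gap_nonneg[OF i, of "l(i := 0)" "l i"] by (simp add: gap_def)
  moreover have "l i * U i l \<le> l i" using utility_range(2)[OF i] l by (simp add: mult_left_le)
  ultimately show ?thesis by (simp add: payment_eq)
qed

text \<open>Intermediate value theorem: the total payment of a constant bid is continuous, vanishes
  at \<open>0\<close>, and can exceed \<open>T\<close> in round \<open>0\<close> alone.\<close>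

lemma budget_exhausted:
  assumes i: "i < n"
  obtains a where "0 < a" "(\<Sum>t<T. P i ((b t)(i := a))) = real T"
proof -
  let ?f = "\<lambda>a. \<Sum>t<T. P i ((b t)(i := a))"
  obtain j0 j1 where j: "j0 < n" "j1 < n" "u i j0 = 0" "u i j1 = 1"
    using has_zero[OF i] has_one[OF i] by blast
  obtain A where A: "0 \<le> A" "real T \<le> P i ((b 0)(i := A))"
    using payment_unbounded[OF i j, where M = "real T" and l = "b 0"] by blast
  have f0: "?f 0 = 0" by (simp add: payment_zero)
  have "P i ((b 0)(i := A)) \<le> ?f A"
    using T_pos payment_nonneg[OF i A(1)]
    by (intro member_le_sum[where f = "\<lambda>t. P i ((b t)(i := A))"]) auto
  then have "real T \<le> ?f A" using A by linarith
  moreover have "continuous_on {0..A} ?f"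
    by (intro continuous_intros continuous_payment i)
  ultimately obtain a where a: "0 \<le> a" "?f a = real T"
    using IVT'[of ?f 0 "real T" A] A f0 by auto
  then have "a \<noteq> 0" using f0 T_pos by auto
  then show ?thesis using that[of a] a by simp
qed

text \<open>Overwriting the bid \<open>s t\<close> by \<open>a\<close> forgets \<open>s t\<close>,
  so \<open>gap_lagrangian\<close> compares the constant bid with the sequence round by
  round.\<close>

lemma deviation_lagrangian:
  "a * (deviation_utility n F u T b i (\<lambda>_. a) - deviation_utility n F u T b i s) =
     (\<Sum>t<T. gap i ((b t)(i := s t)) a)
       + (deviation_payment n F u T b i (\<lambda>_. a) - deviation_payment n F u T b i s)"
proof -
  have "(\<Sum>t<T. gap i ((b t)(i := s t)) a) =
      (\<Sum>t<T. a * U i ((b t)(i := a)) - P i ((b t)(i := a)) -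
        (a * U i ((b t)(i := s t)) - P i ((b t)(i := s t))))"
    by (intro sum.cong refl) (simp flip: gap_lagrangian)
  then show ?thesis
    by (simp add: deviation_utility_def deviation_payment_def sum_subtractf sum.distrib
        algebra_simps sum_distrib_left)
qed

text \<open>An affordable competitor spends no more than the constant bid and has a positive gap in
  some round, so by \<open>deviation_lagrangian\<close> its utility is strictly smaller.\<close>

lemma best_response_sequence_eq:
  assumes i: "i < n" and a: "0 < a" "deviation_payment n F u T b i (\<lambda>_. a) = real T"
  shows "best_response_sequence n F u T b i = restrict (\<lambda>_. a) {..<T}"
proof -
  let ?c = "restrict (\<lambda>_. a) {..<T}"
  obtain j0 j1 where j: "j0 < n" "j1 < n" "u i j0 = 0" "u i j1 = 1"
    using has_zero[OF i] has_one[OF i] by blast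
  have c: "deviation_utility n F u T b i ?c = deviation_utility n F u T b i (\<lambda>_. a)"
    "deviation_payment n F u T b i ?c = deviation_payment n F u T b i (\<lambda>_. a)"
    unfolding deviation_utility_def deviation_payment_def by (auto intro!: sum.cong)
  have feas: "?c \<in> {..<T} \<rightarrow>\<^sub>E {0..}" "deviation_payment n F u T b i ?c \<le> real T"
    unfolding restrict_PiE_iff c using a by auto
  have better: "deviation_utility n F u T b i s < deviation_utility n F u T b i ?c"
    if s: "s \<in> {..<T} \<rightarrow>\<^sub>E {0..}" "deviation_payment n F u T b i s \<le> real T" "s \<noteq> ?c" for s
  proof -
    \<comment> \<open>Sequences are extensional, so a different sequence differs in an actual
      round.\<close>
    have "\<exists>t<T. s t \<noteq> a"
    proof (rule ccontr)
      assume "\<not> ?thesis"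
      then have "s = ?c" by (intro PiE_ext[OF s(1) feas(1)]) auto
      then show False using s(3) by simp
    qed
    then obtain t where t: "t < T" "s t \<noteq> a" by blast
    have "0 < (\<Sum>t<T. gap i ((b t)(i := s t)) a)"
    proof (rule sum_pos2[of _ t])
      show "0 < gap i ((b t)(i := s t)) a" using t by (intro gap_pos[OF i j]) auto
    qed (use t gap_nonneg[OF i] in auto)
    then have "0 < a * (deviation_utility n F u T b i (\<lambda>_. a) - deviation_utility n F u T b i s)"
      using deviation_lagrangian[of a i s] s(2) a(2) by linarith
    then show ?thesis using a(1) by (simp add: c zero_less_mult_iff)
  qed
  show ?thesis
    unfolding best_response_sequence_def
  proof (rule the_equality)
    show "is_arg_max (deviation_utility n F u T b i)
        (\<lambda>s. s \<in> {..<T} \<rightarrow>\<^sub>E {0..} \<and> deviation_payment n F u T b i s \<le> real T) ?c"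
      unfolding is_arg_max_def using feas better by (blast dest: order_less_asym)
  next
    fix s assume "is_arg_max (deviation_utility n F u T b i)
        (\<lambda>s. s \<in> {..<T} \<rightarrow>\<^sub>E {0..} \<and> deviation_payment n F u T b i s \<le> real T) s"
    then show "s = ?c"
      unfolding is_arg_max_def using feas better by blast
  qed
qed

definition r :: "nat \<Rightarrow> real" where
  "r i = best_response n F u L T b i"

lemma best_response_properties:
  assumes i: "i < n"
  shows "1 \<le> r i" "r i \<le> L" "(\<Sum>t<T. P i ((b t)(i := r i))) \<le> real T"
    "(\<Sum>t<T. P i (b t)) \<le> (\<Sum>t<T. P i ((b t)(i := r i)))"
    "r i = L \<or> (\<Sum>t<T. P i ((b t)(i := r i))) = real T"
proof -
  obtain a where a: "0 < a" "(\<Sum>t<T. P i ((b t)(i := a))) = real T"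
    using budget_exhausted[OF i] by blast
  have "0 < T" using T_pos by simp
  then have "(THE v. \<forall>t<T. best_response_sequence n F u T b i t = v) = a"
    using a best_response_sequence_eq[OF i a(1)]
    by (intro the_equality) (auto simp: deviation_payment_def)
  then have r: "r i = min a L" by (simp add: r_def best_response_def)
  \<comment> \<open>A payment never exceeds the bid, so \<open>T\<close> rounds at \<open>a\<close>
    can cost \<open>T\<close> only if \<open>a \<ge> 1\<close>.\<close>
  have "real T \<le> (\<Sum>t<T. a)"
    unfolding a(2)[symmetric] using payment_le_bid[OF i, of "(b _)(i := a)"] a(1)
    by (intro sum_mono) (metis fun_upd_same less_imp_le)
  then have "1 \<le> a" using T_pos by simp
  then show "1 \<le> r i" "r i \<le> L" using r L_gt by auto
  show "r i = L \<or> (\<Sum>t<T. P i ((b t)(i := r i))) = real T"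
    using r a(2) by (cases "a \<le> L") auto
  have "(\<Sum>t<T. P i ((b t)(i := r i))) \<le> (\<Sum>t<T. P i ((b t)(i := a)))"
  proof (rule sum_mono)
    fix t
    show "P i ((b t)(i := r i)) \<le> P i ((b t)(i := a))"
      using payment_mono[OF i, of "(b t)(i := r i)" a] \<open>1 \<le> r i\<close> r by simp
  qed
  then show "(\<Sum>t<T. P i ((b t)(i := r i))) \<le> real T" using a by simp
  \<comment> \<open>If the best response is not capped, it spends the whole budget; if it is capped,
    no actual bid exceeds it.\<close>
  show "(\<Sum>t<T. P i (b t)) \<le> (\<Sum>t<T. P i ((b t)(i := r i)))"
  proof (cases "a \<le> L")
    case True
    then show ?thesis using r a(2) budget[OF i] by simp
  next
    case False
    then have "r i = L" using r by simp
    then show ?thesis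
      using bids i by (intro sum_mono payment_mono) auto
  qed
qed

text \<open>A constant bid is the Dirac measure at its sequence. Evaluating the integrals needs
  measurability, which follows from continuity in the own bid of each round.\<close>

lemma strong_regret_ge:
  assumes i: "i < n" and a: "0 \<le> a" "a \<le> L" and pay: "(\<Sum>t<T. P i ((b t)(i := a))) \<le> real T"
  shows "ereal (\<Sum>t<T. U i ((b t)(i := a)) - U i (b t)) \<le> strong_regret n F u L T b i"
proof -
  let ?N = "PiM {..<T} (\<lambda>_. restrict_space borel {0..L})"
  let ?c = "restrict (\<lambda>_. a) {..<T}"
  let ?M = "return ?N ?c"
  have c: "?c \<in> space ?N"
    using a by (simp add: space_PiM space_restrict_space restrict_PiE_iff)
  have meas: "(\<lambda>s. \<Sum>t<T. f t (s t)) \<in> borel_measurable ?N"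
    if "\<And>t. continuous_on UNIV (f t)" for f :: "nat \<Rightarrow> real \<Rightarrow> real"
  proof (intro borel_measurable_sum)
    fix t assume t: "t \<in> {..<T}"
    have "f t \<in> borel_measurable (restrict_space borel {0..L})"
      by (intro measurable_restrict_space1 borel_measurable_continuous_onI that)
    with measurable_component_singleton[OF t]
    show "(\<lambda>s. f t (s t)) \<in> borel_measurable ?N"
      by (rule measurable_compose)
  qed
  have "integral\<^sup>L ?M (deviation_payment n F u T b i) = deviation_payment n F u T b i ?c"
    unfolding deviation_payment_def
    by (intro integral_return c meas continuous_payment i)
  also have "\<dots> = (\<Sum>t<T. P i ((b t)(i := a)))"
    by (simp add: deviation_payment_def)
  finally have "?M \<in> affordable_strategies n F u L T b i"
    using pay c by (simp add: affordable_strategies_def prob_space_return)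
  moreover have "integral\<^sup>L ?M (deviation_utility n F u T b i) = deviation_utility n F u T b i ?c"
    unfolding deviation_utility_def
    by (intro integral_return c meas continuous_utility i)
  then have "integral\<^sup>L ?M (deviation_utility n F u T b i) - (\<Sum>t<T. U i (b t)) =
      (\<Sum>t<T. U i ((b t)(i := a)) - U i (b t))"
    by (simp add: deviation_utility_def sum_subtractf)
  ultimately show ?thesis
    unfolding strong_regret_def by (intro SUP_upper2[of ?M]) auto
qed

end

section \<open>Complementary slackness of the regularized optimum\<close>

context regularized
begin

abbreviation bid_value :: "(nat \<Rightarrow> real) \<Rightarrow> nat \<Rightarrow> nat \<Rightarrow> real" where
  "bid_value l \<equiv> \<lambda>i j. l i * u i j"

lemma bid_value_upd: "(bid_value l)(i := \<lambda>_. 0) = bid_value (l(i := 0))"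
  by auto

text \<open>The failure of complementary slackness in row \<open>i\<close>: the dual slacks weighted
  by the entries of \<open>y\<close>, as \<open>slack_eq\<close> shows.\<close>

definition slack :: "(nat \<Rightarrow> real) \<Rightarrow> (nat \<Rightarrow> nat \<Rightarrow> real) \<Rightarrow> nat \<Rightarrow> real" where
  "slack l y i = marginal n (bid_value l) i + (\<Sum>j<n. vcg_price n (bid_value l) j * y i j) - l i * score i y"

lemma slack_eq:
  assumes "y \<in> bistochastic n" "i < n"
  shows "slack l y i =
    (\<Sum>j<n. (marginal n (bid_value l) i + vcg_price n (bid_value l) j - bid_value l i j) * y i j)"
proof -
  have "(\<Sum>j<n. marginal n (bid_value l) i * y i j) = marginal n (bid_value l) i"
    using bistochasticD(3)[OF assms] by (simp flip: sum_distrib_left)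
  then show ?thesis
    by (simp add: slack_def score_def left_diff_distrib distrib_right sum.distrib sum_subtractf
        sum_distrib_left mult.assoc)
qed

lemma slack_nonneg:
  assumes "y \<in> bistochastic n" "i < n"
  shows "0 \<le> slack l y i"
  unfolding slack_eq[OF assms]
  using marginal_price_covers[of i n _ "bid_value l"] assms
  by (intro sum_nonneg mult_nonneg_nonneg) (auto simp: bistochasticD)

text \<open>The columns of \<open>y\<close> sum to \<open>1\<close>, so the total slack is the dual
  value minus the welfare, and \<open>marginal_price_sum_le\<close> bounds the dual value.\<close>

lemma slack_sum_le:
  assumes y: "y \<in> bistochastic n"
  shows "(\<Sum>i<n. slack l y i) \<le> vcg_opt n (bid_value l) - welfare l y"
proof -
  have "(\<Sum>i<n. \<Sum>j<n. vcg_price n (bid_value l) j * y i j) = (\<Sum>j<n. vcg_price n (bid_value l) j)"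
    by (subst sum.swap) (simp add: bistochasticD(4)[OF y] flip: sum_distrib_left)
  then show ?thesis
    using marginal_price_sum_le[of n "bid_value l"]
    by (simp add: slack_def welfare_def sum.distrib sum_subtractf)
qed

lemma slack_le:
  assumes y: "y \<in> bistochastic n" and i: "i < n"
  shows "slack l y i \<le> vcg_opt n (bid_value l) - welfare l y"
proof -
  have "slack l y i \<le> (\<Sum>i<n. slack l y i)"
    using slack_nonneg[OF y] i by (intro member_le_sum) auto
  then show ?thesis using slack_sum_le[OF y, of l] by simp
qed

text \<open>Weak duality: nonnegative slacks keep the welfare of a fractional matrix below the best
  permutation, and the cost only lowers the gain.\<close>

lemma opt0_le_vcg_opt: "\<Phi> l \<le> vcg_opt n (bid_value l)"
proof -
  have "0 \<le> (\<Sum>i<n. slack l (x l) i)"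
    using slack_nonneg[OF allocation_bistochastic] by (intro sum_nonneg) auto
  then show ?thesis
    using slack_sum_le[OF allocation_bistochastic, of l l] cost_nonneg[OF allocation_bistochastic, of l]
    by (simp add: opt0_eq gain_def)
qed

text \<open>The candidate is an optimal permutation smoothed by \<open>perm_mix\<close>; its lost
  welfare is at most \<open>\<theta> * n * L\<close>.\<close>

lemma opt0_ge_vcg_opt:
  assumes l: "\<And>k. k < n \<Longrightarrow> 0 \<le> l k \<and> l k \<le> L" and \<theta>: "0 < \<theta>" "\<theta> \<le> 1"
  shows "vcg_opt n (bid_value l) - \<theta> * (real n * L) - real n ^ 3 * \<beta> / \<theta> \<le> \<Phi> l"
proof -
  obtain p where p: "p permutes {..<n}" "vcg_opt n (bid_value l) = (\<Sum>i<n. bid_value l i (p i))"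
    by (rule vcg_opt_attained)
  obtain z where z: "z \<in> pos_bistochastic" "cost z \<le> real n ^ 3 * \<beta> / \<theta>"
    "\<And>k. k < n \<Longrightarrow> (1 - \<theta>) * u k (p k) \<le> score k z"
    using perm_mix[OF p(1) \<theta>] by blast
  have "(1 - \<theta>) * vcg_opt n (bid_value l) \<le> welfare l z"
    unfolding p(2) welfare_def sum_distrib_left
  proof (rule sum_mono)
    fix k assume "k \<in> {..<n}"
    then show "(1 - \<theta>) * (l k * u k (p k)) \<le> l k * score k z"
      using mult_left_mono[OF z(3)[of k], of "l k"] l[of k] by (simp add: mult_ac)
  qed
  moreover have "vcg_opt n (bid_value l) \<le> (\<Sum>i<n. L)"
    unfolding p(2)
  proof (rule sum_mono)
    fix k assume "k \<in> {..<n}"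
    then have "l k * u k (p k) \<le> L * 1"
      using l[of k] u_range[of k "p k"] permutes_in_image[OF p(1), of k] by (intro mult_mono) auto
    then show "l k * u k (p k) \<le> L" by simp
  qed
  then have "\<theta> * vcg_opt n (bid_value l) \<le> \<theta> * (real n * L)"
    using \<theta> by (intro mult_left_mono) auto
  ultimately show ?thesis
    using gain_le_opt0[OF z(1), of l] z(2) by (simp add: gain_def algebra_simps)
qed

end

section \<open>Low regret forces an approximate equilibrium\<close>

locale low_regret = market +
  fixes \<epsilon> :: real
  assumes \<beta>_eq: "\<beta> = 1 / (L ^ 3 * real n ^ 4)"
    and \<epsilon>_pos: "0 < \<epsilon>" and \<epsilon>_le: "\<epsilon> \<le> 1 / 1000 / (L ^ 12 * real n ^ 22)"
    and regret: "\<And>i. i < n \<Longrightarrow> strong_regret n F u L T b i < ereal (\<epsilon> * real T)"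
begin

lemma n_ge: "1 \<le> real n" using n_pos by simp

lemma opt0_approx:
  assumes l: "\<And>k. k < n \<Longrightarrow> 0 \<le> l k \<and> l k \<le> L"
  shows "vcg_opt n (bid_value l) - 2 / L \<le> \<Phi> l"
proof -
  \<comment> \<open>This choice balances the errors: lost welfare and barrier cost both become
    \<open>1 / L\<close>.\<close>
  let ?\<theta> = "1 / (L ^ 2 * real n)"
  have "1 \<le> L ^ 2 * real n"
    using L_gt n_ge mult_mono[of 1 "L ^ 2" 1 "real n"] by simp
  then have \<theta>: "0 < ?\<theta>" "?\<theta> \<le> 1"
    using L_gt n_pos by simp_all
  have "?\<theta> * (real n * L) + real n ^ 3 * \<beta> / ?\<theta> = 2 / L"
    using L_gt n_pos by (simp add: \<beta>_eq field_simps eval_nat_numeral)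
  moreover have "vcg_opt n (bid_value l) - ?\<theta> * (real n * L) - real n ^ 3 * \<beta> / ?\<theta> \<le> \<Phi> l"
    by (intro opt0_ge_vcg_opt l \<theta>)
  ultimately show ?thesis by linarith
qed

text \<open>The welfare advantage over \<open>uniform\<close> is at most \<open>n * L\<close>, which
  also dominates \<open>\<beta> * n^3 \<le> 1\<close>. Hence \<open>floor_entry\<close> is at least
  \<open>\<beta> / (2 * n * L)\<close>.\<close>

lemma entries_ge:
  assumes t: "t < T"
  shows "\<forall>i<n. \<forall>j<n. 1 / (2 * L ^ 4 * real n ^ 5) \<le> x (b t) i j"
proof (intro allI impI)
  fix i j assume ij: "i < n" "j < n"
  have "welfare (b t) (x (b t)) \<le> (\<Sum>k<n. \<bar>b t k\<bar>)"
    using welfare_abs_le[OF allocation_bistochastic, of "b t" "b t"] by simp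
  also have "\<dots> \<le> (\<Sum>k<n. L)" using bids[OF t] by (intro sum_mono) auto
  finally have "welfare (b t) (x (b t)) \<le> real n * L" by simp
  moreover have "0 \<le> welfare (b t) uniform"
    unfolding welfare_def using bids[OF t] score_range uniform_bistochastic
    by (intro sum_nonneg mult_nonneg_nonneg) (auto simp: pos_bistochastic_def)
  ultimately have "floor_entry (real n * L) \<le> x (b t) i j"
    using gain_le_opt0[OF uniform_bistochastic, of "b t"] L_gt
    by (intro entries_ge_floor[OF allocation_pos _ _ _ ij]) (auto simp: opt0_eq)
  moreover have "1 / (2 * L ^ 4 * real n ^ 5) \<le> floor_entry (real n * L)"
  proof -
    have "\<beta> * real n ^ 3 \<le> 1"
    proof -
      have "\<beta> * real n ^ 3 = 1 / (L ^ 3 * real n)"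
        using n_pos L_gt by (simp add: \<beta>_eq field_simps eval_nat_numeral)
      also have "\<dots> \<le> 1"
        using L_gt n_ge mult_mono[of 1 "L ^ 3" 1 "real n"] by simp
      finally show ?thesis .
    qed
    also have "\<dots> \<le> real n * L" using L_gt n_ge mult_mono[of 1 "real n" 1 L] by simp
    finally have "\<beta> / (2 * (real n * L)) \<le> \<beta> / (\<beta> * real n ^ 3 + real n * L)"
      using \<beta>_pos n_pos L_gt by (intro divide_left_mono mult_pos_pos add_pos_pos) (auto simp: mult.commute)
    moreover have "\<beta> / (2 * (real n * L)) = 1 / (2 * L ^ 4 * real n ^ 5)"
      using n_pos L_gt by (simp add: \<beta>_eq field_simps eval_nat_numeral)
    ultimately show ?thesis by (simp add: floor_entry_def)
  qed
  ultimately show "1 / (2 * L ^ 4 * real n ^ 5) \<le> x (b t) i j" by linarith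
qed

lemma regret_bound:
  assumes i: "i < n"
  shows "(\<Sum>t<T. U i ((b t)(i := r i)) - U i (b t)) \<le> \<epsilon> * real T"
proof -
  note R = best_response_properties[OF i]
  have "0 \<le> r i" using R(1) by simp
  from order_le_less_trans[OF strong_regret_ge[OF i this R(2) R(3)] regret[OF i]]
  show ?thesis by simp
qed

text \<open>By \<open>gap_lagrangian\<close> the left side is \<open>r i\<close> times the regret
  against the constant bid \<open>r i\<close>. Both summands are nonnegative, so low regret controls
  the bid distances and the unspent money at once.\<close>

lemma gap_payment_sum:
  assumes i: "i < n"
  shows "(\<Sum>t<T. gap i (b t) (r i)) + ((\<Sum>t<T. P i ((b t)(i := r i))) - (\<Sum>t<T. P i (b t)))
    \<le> L * \<epsilon> * real T"
proof -
  note R = best_response_properties[OF i]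
  have "(\<Sum>t<T. gap i (b t) (r i)) + ((\<Sum>t<T. P i ((b t)(i := r i))) - (\<Sum>t<T. P i (b t)))
     = r i * (\<Sum>t<T. U i ((b t)(i := r i)) - U i (b t))"
    unfolding gap_lagrangian[symmetric]
    by (simp add: sum_subtractf sum.distrib algebra_simps sum_distrib_left)
  also have "\<dots> \<le> r i * (\<epsilon> * real T)"
    using R(1) by (intro mult_left_mono regret_bound i) auto
  also have "\<dots> \<le> L * (\<epsilon> * real T)"
    using R(2) \<epsilon>_pos by (intro mult_right_mono) auto
  finally show ?thesis by simp
qed

text \<open>The gaps have a small sum and are at least quadratic in the deviations; the inequality
  of arithmetic and geometric means turns this into a bound on the sum of deviations.\<close>

lemma bid_deviation_sum:
  assumes i: "i < n"
  shows "(\<Sum>t<T. \<bar>r i - b t i\<bar>) \<le> real T / (3 * L * real n)"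
proof -
  note R = best_response_properties[OF i]
  obtain j0 j1 where j: "j0 < n" "j1 < n" "u i j0 = 0" "u i j1 = 1"
    using has_zero[OF i] has_one[OF i] by blast
  define m where "m = 1 / (2 * L ^ 4 * real n ^ 5)"
  \<comment> \<open>Exactly \<open>4 * n^2 * \<beta> / m^3\<close>; it also dominates
    \<open>2 * L / m\<close>, the other requirement of \<open>gap_ge_square\<close>.\<close>
  define K where "K = 32 * L ^ 9 * real n ^ 13"
  define \<eta> where "\<eta> = 1 / (3 * L * real n)"
  have m: "0 < m" and K: "0 < K" and \<eta>: "0 < \<eta>"
    using L_gt n_pos by (simp_all add: m_def K_def \<eta>_def)
  have K1: "4 * real n ^ 2 * \<beta> / m ^ 3 \<le> K"
    using L_gt n_pos by (simp add: m_def K_def \<beta>_eq field_simps eval_nat_numeral)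
  have gap: "(r i - b t i)\<^sup>2 \<le> 2 * K * gap i (b t) (r i)" if t: "t < T" for t
  proof -
    have "\<bar>r i - b t i\<bar> \<le> L" using R bids[OF t i] by auto
    then have "2 * \<bar>r i - b t i\<bar> / m \<le> 2 * L / m"
      using m by (intro divide_right_mono) auto
    also have "\<dots> = 4 * (L ^ 5 * real n ^ 5)"
      by (simp add: m_def eval_nat_numeral)
    also have "\<dots> \<le> 32 * (L ^ 9 * real n ^ 13)"
      using L_gt n_ge by (intro mult_mono power_increasing) auto
    finally have "2 * \<bar>r i - b t i\<bar> / m \<le> K" by (simp add: K_def)
    then have "(r i - b t i)\<^sup>2 / (2 * K) \<le> gap i (b t) (r i)"
      using entries_ge[OF t] m K K1 by (intro gap_ge_square[OF i j]) (auto simp: m_def)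
    then show ?thesis using K by (simp add: field_simps)
  qed
  \<comment> \<open>The bound on \<open>\<epsilon>\<close> enters here: the power
    \<open>L^12\<close> cancels the \<open>L^10\<close> of \<open>K * L\<close> down to the
    \<open>L^2\<close> of \<open>\<eta>\<close>.\<close>
  have "K * L * \<epsilon> \<le> \<eta>\<^sup>2 / 2"
  proof -
    have "K * L * \<epsilon> \<le> K * L * (1 / 1000 / (L ^ 12 * real n ^ 22))"
      using K L_gt \<epsilon>_le by (intro mult_left_mono) auto
    also have "\<dots> = 4 / 125 / (L ^ 2 * real n ^ 9)"
      using L_gt n_pos by (simp add: K_def field_simps eval_nat_numeral)
    also have "\<dots> \<le> (1 / 18) / (L ^ 2 * real n ^ 2)"
    proof (rule frac_le)
      show "L ^ 2 * real n ^ 2 \<le> L ^ 2 * real n ^ 9"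
        using n_ge by (intro mult_left_mono power_increasing) auto
    qed (use L_gt n_pos in auto)
    also have "\<dots> = \<eta>\<^sup>2 / 2"
      by (simp add: \<eta>_def power2_eq_square)
    finally show ?thesis .
  qed
  then have KL: "K * L * \<epsilon> / \<eta> \<le> \<eta> / 2"
    using \<eta> by (simp add: field_simps power2_eq_square)
  have "(\<Sum>t<T. \<bar>r i - b t i\<bar>) \<le> (\<Sum>t<T. \<eta> / 2 + K / \<eta> * gap i (b t) (r i))"
  proof (rule sum_mono)
    fix t assume t: "t \<in> {..<T}"
    \<comment> \<open>For a deviation \<open>d\<close> this yields
      \<open>\<bar>d\<bar> \<le> \<eta> / 2 + d^2 / (2 * \<eta>)\<close>.\<close>
    have "0 \<le> (\<eta> - \<bar>r i - b t i\<bar>)\<^sup>2" by simp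
    then have "\<bar>r i - b t i\<bar> * (2 * \<eta>) \<le> \<eta>\<^sup>2 + (r i - b t i)\<^sup>2"
      by (simp add: power2_diff algebra_simps)
    also have "\<dots> \<le> \<eta>\<^sup>2 + 2 * K * gap i (b t) (r i)" using gap t by simp
    also have "\<dots> = (\<eta> / 2 + K / \<eta> * gap i (b t) (r i)) * (2 * \<eta>)"
      using \<eta> by (simp add: field_simps power2_eq_square)
    finally show "\<bar>r i - b t i\<bar> \<le> \<eta> / 2 + K / \<eta> * gap i (b t) (r i)"
      using \<eta> by (simp only: mult_le_cancel_right)
  qed
  also have "\<dots> = real T * (\<eta> / 2) + K / \<eta> * (\<Sum>t<T. gap i (b t) (r i))"
    by (simp add: sum.distrib sum_distrib_left)
  also have "\<dots> \<le> real T * (\<eta> / 2) + K / \<eta> * (L * \<epsilon> * real T)"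
    using gap_payment_sum[OF i] R(4) K \<eta> by (intro add_left_mono mult_left_mono) auto
  also have "\<dots> = real T * (\<eta> / 2 + K * L * \<epsilon> / \<eta>)" by (simp add: algebra_simps)
  also have "\<dots> \<le> real T * \<eta>"
    using KL by (intro mult_left_mono, linarith) simp
  finally show ?thesis by (simp add: \<eta>_def)
qed

section \<open>Averages over the rounds\<close>

definition avg :: "(nat \<Rightarrow> real) \<Rightarrow> real" where
  "avg f = (\<Sum>t<T. f t) / real T"

lemma avg_mono: "(\<And>t. t < T \<Longrightarrow> f t \<le> g t) \<Longrightarrow> avg f \<le> avg g"
  unfolding avg_def by (intro divide_right_mono sum_mono) auto

lemma avg_add: "avg (\<lambda>t. f t + g t) = avg f + avg g"
  by (simp add: avg_def sum.distrib add_divide_distrib)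

lemma avg_diff: "avg (\<lambda>t. f t - g t) = avg f - avg g"
  by (simp add: avg_def sum_subtractf diff_divide_distrib)

lemma avg_const: "avg (\<lambda>t. a) = a"
  using T_pos by (simp add: avg_def)

lemma avg_cmult: "avg (\<lambda>t. a * f t) = a * avg f"
  by (simp add: avg_def sum_distrib_left)

definition err :: "nat \<Rightarrow> real" where
  "err t = (\<Sum>k<n. \<bar>r k - b t k\<bar>)"

lemma avg_err: "avg err \<le> 1 / (3 * L)"
proof -
  have "(\<Sum>t<T. err t) = (\<Sum>k<n. \<Sum>t<T. \<bar>r k - b t k\<bar>)"
    unfolding err_def by (rule sum.swap)
  also have "\<dots> \<le> (\<Sum>k<n. real T / (3 * L * real n))"
    by (intro sum_mono bid_deviation_sum) auto
  also have "\<dots> = 1 / (3 * L) * real T" using n_pos by simp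
  finally show ?thesis
    unfolding avg_def using T_pos by (subst pos_divide_le_eq) auto
qed

abbreviation xbar :: "nat \<Rightarrow> nat \<Rightarrow> real" where
  "xbar \<equiv> average_allocation n F u T b"

lemma xbar_eq: "xbar i j = avg (\<lambda>t. x (b t) i j)"
  by (simp add: average_allocation_def avg_def)

lemma sum_avg: "(\<Sum>k\<in>A. avg (\<lambda>t. f k t)) = avg (\<lambda>t. \<Sum>k\<in>A. f k t)"
  unfolding avg_def sum_divide_distrib[symmetric] by (subst sum.swap) simp

lemma xbar_bistochastic: "xbar \<in> bistochastic n"
proof (rule bistochasticI)
  show "0 \<le> xbar i j" if "i < n" "j < n" for i j
    using avg_mono[of "\<lambda>_. 0" "\<lambda>t. x (b t) i j"] bistochasticD(1)[OF allocation_bistochastic that]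
    by (simp add: xbar_eq avg_const)
  show "(\<Sum>j<n. xbar i j) = 1" if "i < n" for i
    using that by (simp add: xbar_eq sum_avg bistochasticD(3)[OF allocation_bistochastic] avg_const)
  show "(\<Sum>i<n. xbar i j) = 1" if "j < n" for j
    using that by (simp add: xbar_eq sum_avg bistochasticD(4)[OF allocation_bistochastic] avg_const)
  show "xbar i j = 0" if "\<not> (i < n \<and> j < n)" for i j
    using that by (simp add: xbar_eq bistochasticD(5)[OF allocation_bistochastic] avg_const)
qed

lemma score_xbar: "score i xbar = avg (\<lambda>t. U i (b t))"
  by (simp add: score_def xbar_eq sum_avg utility_eq flip: avg_cmult)

lemma r_range: "k < n \<Longrightarrow> 0 \<le> r k \<and> r k \<le> L"
  using best_response_properties[of k] by auto

lemma bid_error_le: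
  assumes "i < n"
  shows "\<bar>r i - b t i\<bar> \<le> err t"
  unfolding err_def using assms by (intro member_le_sum) auto

abbreviation C :: "nat \<Rightarrow> real" where "C \<equiv> vcg_price n (bid_value r)"

text \<open>Replacing the bids of round \<open>t\<close> by the best responses changes each optimal
  value, and the reported value of player \<open>i\<close>, by at most \<open>err t\<close>, hence
  by \<open>e\<close> on average. The terms \<open>2 / L\<close> come from the barrier.\<close>

lemma averaged_estimates:
  assumes i: "i < n"
  defines "e \<equiv> 1 / (3 * L)"
    and "\<Phi>b \<equiv> avg (\<lambda>t. \<Phi> (b t))" and "\<Phi>i \<equiv> avg (\<lambda>t. \<Phi> ((b t)(i := 0)))"
    and "Z \<equiv> avg (\<lambda>t. b t i * U i (b t))"
  shows "\<Phi>b - e \<le> welfare r xbar"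
    "vcg_opt n (bid_value r) - 2 / L - e \<le> \<Phi>b"
    "vcg_opt n (bid_value (r(i := 0))) - 2 / L - e \<le> \<Phi>i"
    "\<Phi>i \<le> vcg_opt n (bid_value (r(i := 0))) + e"
    "\<bar>Z - r i * score i xbar\<bar> \<le> e"
    "avg (\<lambda>t. P i (b t)) = \<Phi>i - \<Phi>b + Z"
proof -
  have bound: "avg f - e \<le> avg g" if "\<And>t. t < T \<Longrightarrow> f t - err t \<le> g t" for f g
  proof -
    have "avg (\<lambda>t. f t - err t) \<le> avg g" using that by (rule avg_mono)
    then show ?thesis using avg_err by (simp add: avg_diff e_def)
  qed
  have "welfare r xbar = avg (\<lambda>t. welfare r (x (b t)))"
    by (simp add: welfare_def score_xbar utility_eq sum_avg flip: avg_cmult)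
  moreover have "\<Phi> (b t) - err t \<le> welfare r (x (b t))" for t
    using gain_diff_le[OF allocation_bistochastic, of r "b t" "b t"] cost_nonneg[OF allocation_bistochastic, of "b t"]
    by (simp add: opt0_eq gain_def err_def)
  ultimately show "\<Phi>b - e \<le> welfare r xbar" unfolding \<Phi>b_def by (simp add: bound)
  have "\<Phi> r - err t \<le> \<Phi> (b t)" for t
    using opt0_diff_le[of r "b t"] by (simp add: err_def)
  from bound[OF this] show "vcg_opt n (bid_value r) - 2 / L - e \<le> \<Phi>b"
    using opt0_approx[of r] r_range unfolding \<Phi>b_def avg_const by fastforce
  have d: "\<bar>\<Phi> (r(i := 0)) - \<Phi> ((b t)(i := 0))\<bar> \<le> err t" for t
    by (rule order_trans[OF opt0_diff_le], unfold err_def, rule sum_mono) simp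
  have "\<Phi> (r(i := 0)) - err t \<le> \<Phi> ((b t)(i := 0))" for t using d[of t] by simp
  from bound[OF this] have "\<Phi> (r(i := 0)) - e \<le> \<Phi>i"
    unfolding \<Phi>i_def avg_const .
  moreover have "vcg_opt n (bid_value (r(i := 0))) - 2 / L \<le> \<Phi> (r(i := 0))"
    using r_range L_gt by (intro opt0_approx) auto
  ultimately show "vcg_opt n (bid_value (r(i := 0))) - 2 / L - e \<le> \<Phi>i" by linarith
  have "\<Phi> ((b t)(i := 0)) - err t \<le> \<Phi> (r(i := 0))" for t using d[of t] by simp
  from bound[OF this] have "\<Phi>i - e \<le> \<Phi> (r(i := 0))"
    unfolding \<Phi>i_def avg_const .
  then show "\<Phi>i \<le> vcg_opt n (bid_value (r(i := 0))) + e"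
    using opt0_le_vcg_opt[of "r(i := 0)"] by linarith
  have z: "\<bar>b t i * U i (b t) - r i * U i (b t)\<bar> \<le> err t" for t
  proof -
    have "\<bar>b t i * U i (b t) - r i * U i (b t)\<bar> = \<bar>r i - b t i\<bar> * U i (b t)"
      using utility_range(1)[OF i] by (simp add: abs_mult abs_minus_commute flip: left_diff_distrib)
    also have "\<dots> \<le> \<bar>r i - b t i\<bar>"
      using utility_range[OF i] by (simp add: mult_left_le)
    finally show ?thesis using bid_error_le[OF i, of t] by linarith
  qed
  have "b t i * U i (b t) - err t \<le> r i * U i (b t)" "r i * U i (b t) - err t \<le> b t i * U i (b t)" for t
    using z[of t] by linarith+
  from bound[OF this(1)] bound[OF this(2)] show "\<bar>Z - r i * score i xbar\<bar> \<le> e"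
    by (simp add: Z_def score_xbar avg_cmult abs_le_iff)
  show "avg (\<lambda>t. P i (b t)) = \<Phi>i - \<Phi>b + Z"
    by (simp add: payment_eq avg_add avg_diff \<Phi>i_def \<Phi>b_def Z_def)
qed

text \<open>An uncapped best response exhausts the budget, and by \<open>gap_payment_sum\<close> the
  actual bids spend at most \<open>L * \<epsilon> * T\<close> less.\<close>

lemma avg_payment:
  assumes i: "i < n"
  shows "avg (\<lambda>t. P i (b t)) \<le> 1" "r i \<noteq> L \<Longrightarrow> 1 - 1 / L \<le> avg (\<lambda>t. P i (b t))"
proof -
  show "avg (\<lambda>t. P i (b t)) \<le> 1"
    unfolding avg_def using budget[OF i] T_pos by simp
  assume "r i \<noteq> L"
  then have "(\<Sum>t<T. P i ((b t)(i := r i))) = real T"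
    using best_response_properties[OF i] by blast
  moreover have "0 \<le> (\<Sum>t<T. gap i (b t) (r i))"
    using gap_nonneg[OF i] by (intro sum_nonneg) auto
  ultimately have "real T - L * \<epsilon> * real T \<le> (\<Sum>t<T. P i (b t))"
    using gap_payment_sum[OF i] by linarith
  then have "1 - L * \<epsilon> \<le> avg (\<lambda>t. P i (b t))"
    unfolding avg_def using T_pos by (simp add: field_simps)
  moreover have "L * \<epsilon> \<le> 1 / L"
  proof -
    have "L * \<epsilon> \<le> L * (1 / 1000 / (L ^ 12 * real n ^ 22))"
      using L_gt \<epsilon>_le by (intro mult_left_mono) auto
    also have "\<dots> = (1 / 1000) / (L ^ 11 * real n ^ 22)"
      using L_gt by (simp add: field_simps eval_nat_numeral)
    also have "\<dots> \<le> 1 / (L ^ 1 * real n ^ 0)"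
      using L_gt n_ge by (intro frac_le mult_mono power_increasing) auto
    finally show ?thesis by simp
  qed
  ultimately show "1 - 1 / L \<le> avg (\<lambda>t. P i (b t))" by linarith
qed

section \<open>Budgets and optimality at the VCG prices\<close>

lemma marginal_eq:
  "marginal n (bid_value r) i = vcg_opt n (bid_value r) - vcg_opt n (bid_value (r(i := 0)))"
  by (simp only: marginal_def bid_value_upd)

text \<open>Solving the definition of \<open>slack\<close> for the expenditure and bounding the
  slack by the duality gap cancels the optimal welfare. What remains is the averaged VCG payment
  formula, up to \<open>2 / L + 3 * e\<close> with \<open>e = 1 / (3 * L)\<close>.\<close>

lemma expenditure_le:
  assumes i: "i < n"
  shows "(\<Sum>j<n. C j * xbar i j) \<le> 1 + 3 / L"
proof -
  have "(\<Sum>j<n. C j * xbar i j) = slack r xbar i + r i * score i xbar - marginal n (bid_value r) i"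
    by (simp add: slack_def)
  then have "(\<Sum>j<n. C j * xbar i j) \<le> avg (\<lambda>t. P i (b t)) + 2 / L + 3 * (1 / (3 * L))"
    using slack_le[OF xbar_bistochastic i, of r] averaged_estimates[OF i]
    unfolding marginal_eq by linarith
  then show ?thesis using avg_payment(1)[OF i] by simp
qed

text \<open>Dual feasibility averaged with the weights \<open>y\<close>.\<close>

lemma indirect_utility_le:
  assumes i: "i < n" and y: "\<And>j. j < n \<Longrightarrow> 0 \<le> y j" "(\<Sum>j<n. y j) = 1"
  shows "r i * (\<Sum>j<n. u i j * y j) \<le> marginal n (bid_value r) i + (\<Sum>j<n. C j * y j)"
proof -
  have "(\<Sum>j<n. marginal n (bid_value r) i * y j) = marginal n (bid_value r) i"
    using y(2) by (simp flip: sum_distrib_left)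
  moreover have "(\<Sum>j<n. bid_value r i j * y j) \<le> (\<Sum>j<n. (marginal n (bid_value r) i + C j) * y j)"
    using marginal_price_covers[OF i, of _ "bid_value r"] y(1)
    by (intro sum_mono mult_right_mono) auto
  ultimately show ?thesis
    by (simp add: distrib_right sum.distrib sum_distrib_left mult.assoc)
qed

lemma utility_competitive:
  assumes i: "i < n" and y: "\<And>j. j < n \<Longrightarrow> 0 \<le> y j" "(\<Sum>j<n. y j) = 1"
    and cy: "(\<Sum>j<n. C j * y j) \<le> 1 + 5 / L"
  shows "(\<Sum>j<n. u i j * y j) \<le> score i xbar + 10 / L"
proof -
  note R = best_response_properties[OF i]
  define D where "D = (\<Sum>j<n. u i j * y j) - score i xbar"
  have D: "r i * D \<le> marginal n (bid_value r) i - r i * score i xbar + (1 + 5 / L)"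
    using indirect_utility_le[OF i y] cy by (simp add: D_def algebra_simps)
  have "D \<le> 10 / L"
  proof (cases "r i = L")
    case True
    \<comment> \<open>Capped case: the money she spends is simply dropped, an error of order
      \<open>1\<close> that becomes \<open>10 / L\<close> after division by
      \<open>r i = L\<close>.\<close>
    have "0 \<le> (\<Sum>j<n. C j * xbar i j)"
      using vcg_price_nonneg bistochasticD(1)[OF xbar_bistochastic i]
      by (intro sum_nonneg mult_nonneg_nonneg) auto
    then have "marginal n (bid_value r) i - r i * score i xbar \<le> slack r xbar i"
      by (simp add: slack_def)
    also have "\<dots> \<le> 2 / L + 2 * (1 / (3 * L))"
      using slack_le[OF xbar_bistochastic i, of r] averaged_estimates(1,2)[OF i] by linarith
    finally have "r i * D \<le> 1 + 5 / L + 2 / L + 2 * (1 / (3 * L))"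
      using D by linarith
    then have "L * D \<le> 1 + 5 / L + 2 / L + 2 * (1 / (3 * L))" by (simp only: True)
    also have "\<dots> \<le> 10"
      using L_gt by (simp add: field_simps)
    finally show ?thesis using L_gt by (simp add: field_simps)
  next
    case False
    \<comment> \<open>Uncapped case: she spends at least \<open>1 - 1 / L\<close>, which offsets the
      cost \<open>1 + 5 / L\<close> of the competing bundle up to \<open>O(1 / L)\<close>, and
      \<open>r i \<ge> 1\<close>.\<close>
    have "marginal n (bid_value r) i - r i * score i xbar \<le> - (avg (\<lambda>t. P i (b t)) - 2 / L - 3 * (1 / (3 * L)))"
      using averaged_estimates[OF i] unfolding marginal_eq by linarith
    moreover have "0 \<le> 1 / L" "10 / L = 10 * (1 / L)" "5 / L = 5 * (1 / L)" "2 / L = 2 * (1 / L)"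
      "1 / (3 * L) = 1 / L / 3"
      using L_gt by auto
    ultimately have "r i * D \<le> 10 / L"
      using D avg_payment(2)[OF i False] by linarith
    show ?thesis
    proof (cases "0 \<le> D")
      case True
      then have "1 * D \<le> r i * D" using R(1) by (intro mult_right_mono)
      with \<open>r i * D \<le> 10 / L\<close> show ?thesis by simp
    next
      case False
      moreover have "0 \<le> 10 / L" using L_gt by simp
      ultimately show ?thesis by linarith
    qed
  qed
  then show ?thesis by (simp add: D_def)
qed

text \<open>Scaling the prices by \<open>1 - z\<close> absorbs the overspending
  \<open>3 / L \<le> z\<close>. In return more bundles become affordable, but at the original prices
  they still cost at most \<open>1 + 5 / L\<close>.\<close>

lemma competitive_equilibrium_xbar:
  "competitive_equilibrium n u (10 / L) (\<lambda>j. (1 - 10 / L / 3) * C j) xbar"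
proof -
  define z where "z = 10 / L / 3"
  have z: "0 < z" "z < 1 / 3" "5 / L = 3 / 2 * z" "3 / L \<le> z"
    using L_gt by (auto simp: z_def field_simps)
  have dist: "(\<Sum>j<n. (1 - z) * C j * y j) = (1 - z) * (\<Sum>j<n. C j * y j)" for y
    by (simp add: sum_distrib_left mult.assoc)
  have "(\<Sum>j<n. (1 - z) * C j * xbar i j) \<le> 1" if "i < n" for i
  proof -
    have "(1 - z) * (\<Sum>j<n. C j * xbar i j) \<le> (1 - z) * (1 + z)"
      using expenditure_le[OF that] z by (intro mult_left_mono) auto
    also have "\<dots> \<le> 1" by (simp add: algebra_simps)
    finally show ?thesis by (simp only: dist)
  qed
  moreover have "(\<Sum>j<n. u i j * y j) \<le> (\<Sum>j<n. u i j * xbar i j) + 10 / L"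
    if i: "i < n" and y: "\<forall>j<n. 0 \<le> y j" "(\<Sum>j<n. y j) = 1" "(\<Sum>j<n. (1 - z) * C j * y j) \<le> 1"
    for i and y :: "nat \<Rightarrow> real"
  proof -
    \<comment> \<open>The product is \<open>1 + z / 2 - 3 / 2 * z^2\<close>, at least
      \<open>1\<close> because \<open>z < 1 / 3\<close>; this is the condition
      \<open>L > 10\<close>.\<close>
    have "1 \<le> (1 - z) * (1 + 3 / 2 * z)"
      using z mult_left_mono[of z "1 / 3" z] by (simp add: algebra_simps)
    then have "(1 - z) * (\<Sum>j<n. C j * y j) \<le> (1 - z) * (1 + 3 / 2 * z)"
      using y(3) by (simp only: dist)
    then have "(\<Sum>j<n. C j * y j) \<le> 1 + 5 / L"
      using z by simp
    then show ?thesis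
      using utility_competitive[OF i _ y(2)] y(1) by (simp add: score_def)
  qed
  ultimately show ?thesis
    using xbar_bistochastic by (simp add: competitive_equilibrium_def z_def)
qed

end

theorem theorem13:
  "\<exists>c::real. c > 0 \<and>
    (\<forall>(n::nat) (u :: nat \<Rightarrow> nat \<Rightarrow> real) (L::real) (T::nat) (b :: nat \<Rightarrow> nat \<Rightarrow> real) (\<epsilon>::real).
      let \<beta> = 1 / (L ^ 3 * real n ^ 4);
          F = separable_regularizer n (inverse_barrier \<beta>);
          \<delta> = 10 / L;
          C = vcg_price n (\<lambda>i j. best_response n F u L T b i * u i j)
      in
        n \<ge> 1 \<and> T \<ge> 1 \<and>
        (\<forall>i<n. \<forall>j<n. u i j \<in> {0..1}) \<and>
        (\<forall>i<n. Min (u i ` {..<n}) = 0 \<and> Max (u i ` {..<n}) = 1) \<and>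
        L > 10 \<and>
        feasible_execution n F u L T b \<and>
        0 < \<epsilon> \<and> \<epsilon> \<le> c / (L ^ 12 * real n ^ 22) \<and>
        (\<forall>i<n. strong_regret n F u L T b i < ereal (\<epsilon> * real T))
        \<longrightarrow>
        competitive_equilibrium n u \<delta> (\<lambda>j. (1 - \<delta> / 3) * C j) (average_allocation n F u T b))"
  unfolding Let_def
\<comment> \<open>\<open>bid_deviation_sum\<close> needs \<open>32 * c \<le> 1 / 18\<close>, which
  \<open>1 / 1000\<close> satisfies.\<close>
proof (intro exI[of _ "1 / 1000"] conjI allI impI)
  fix n :: nat and u :: "nat \<Rightarrow> nat \<Rightarrow> real" and L :: real and T :: nat
    and b :: "nat \<Rightarrow> nat \<Rightarrow> real" and \<epsilon> :: real
  define \<beta> where "\<beta> = 1 / (L ^ 3 * real n ^ 4)"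
  define F where "F = separable_regularizer n (inverse_barrier \<beta>)"
  assume "n \<ge> 1 \<and> T \<ge> 1 \<and>
        (\<forall>i<n. \<forall>j<n. u i j \<in> {0..1}) \<and>
        (\<forall>i<n. Min (u i ` {..<n}) = 0 \<and> Max (u i ` {..<n}) = 1) \<and>
        L > 10 \<and>
        feasible_execution n (separable_regularizer n (inverse_barrier (1 / (L ^ 3 * real n ^ 4)))) u L T b \<and>
        0 < \<epsilon> \<and> \<epsilon> \<le> 1 / 1000 / (L ^ 12 * real n ^ 22) \<and>
        (\<forall>i<n. strong_regret n (separable_regularizer n (inverse_barrier (1 / (L ^ 3 * real n ^ 4)))) u L T b i
          < ereal (\<epsilon> * real T))"
  then have A: "n \<ge> 1" "T \<ge> 1" "\<forall>i<n. \<forall>j<n. u i j \<in> {0..1}"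
    "\<forall>i<n. Min (u i ` {..<n}) = 0 \<and> Max (u i ` {..<n}) = 1" "L > 10"
    "feasible_execution n F u L T b" "0 < \<epsilon>" "\<epsilon> \<le> 1 / 1000 / (L ^ 12 * real n ^ 22)"
    "\<forall>i<n. strong_regret n F u L T b i < ereal (\<epsilon> * real T)"
    unfolding \<beta>_def F_def by blast+
  interpret low_regret n u \<beta> L T b \<epsilon>
  proof unfold_locales
    fix i assume i: "i < n"
    have ne: "finite (u i ` {..<n})" "u i ` {..<n} \<noteq> {}" using i by auto
    show "\<exists>j<n. u i j = 0" using Min_in[OF ne] A(4) i by auto
    show "\<exists>j<n. u i j = 1" using Max_in[OF ne] A(4) i by auto
  qed (use A in \<open>auto simp: \<beta>_def F_def feasible_execution_def\<close>)
  have "r = best_response n (separable_regularizer n (inverse_barrier \<beta>)) u L T b"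
    by (rule ext) (rule r_def)
  from competitive_equilibrium_xbar[unfolded this]
  show "competitive_equilibrium n u (10 / L)
     (\<lambda>j. (1 - 10 / L / 3) *
        vcg_price n (\<lambda>i j. best_response n (separable_regularizer n
          (inverse_barrier (1 / (L ^ 3 * real n ^ 4)))) u L T b i * u i j) j)
     (average_allocation n (separable_regularizer n (inverse_barrier (1 / (L ^ 3 * real n ^ 4)))) u T b)"
    unfolding \<beta>_def .
qed simp

end
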